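(* Let $\lambda=\langle0^{m_0},1^{m_1},\dots,s^{m_s}\rangle$ be a partition with $n=\sum_{r=0}^s m_r$ parts and $m_0\ge1$, and let $x_1,\dots,x_n>0$. Consider the multiline process with content $\lambda$ in stationarity, say $(\hat\eta_u,u\ge0)$, where $u$ is the time parameter. Then the projection $(\Pi(\hat\eta_u),u\ge0)$ is the multispecies PushTASEP process with content $\lambda$ and site parameters $x_1,\dots,x_n$ in stationarity.
   Context: **Content and configurations.** $\langle 0^{m_0},1^{m_1},\dots,s^{m_s}\rangle$ denotes the partition $\lambda$ of length $n$ with exactly $m_r$ parts equal to $r$; $M_r=m_r+\cdots+m_s$ for $1\le r\le s$. $\Omega_\lambda$ is the set of all distinct rearrangements $\eta=(\eta_1,\dots,\eta_n)$ of $\lambda$. **Multispecies PushTASEP.** The sites $1,2,\dots,n$ are arranged clockwise on a ring (site $n$ is followed by site $1$). $\eta_j=r\ge1$ means that site $j$ holds a particle of species $r$; $\eta_j=0$ means that site $j$ is vacant. The process is the continuous-time Markov chain on $\Omega_\lambda$ in which a bell rings at each site $j$ independently at rate $1/x_j$. If site $j$ is vacant when its bell rings, nothing changes. Otherwise let $i_1=\eta_j$; this particle moves to the first site $j_2$ clockwise from $j$ with $i_2:=\eta_{j_2}<i_1$. If $i_2=0$ the jump is complete; otherwise the displaced particle of species $i_2$ moves to the first site $j_3$ clockwise from $j_2$ with $\eta_{j_3}<i_2$, and so on until a vacancy is filled. All these moves occur instantaneously and site $j$ is left vacant. **Multiline diagrams.** $\widehat\Omega_\lambda$ is the set of configurations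 on the array with rows $1,\dots,s$ (from bottom to top) and columns $1,\dots,n$ (from left to right, arranged cyclically), in which each site holds either one particle or a vacancy, and row $r$ contains exactly $M_r$ particles. **Multiline process.** The continuous-time Markov chain on $\widehat\Omega_\lambda$ in which, independently for each column $i$, a bell rings at rate $1/x_i$ at $(1,i_1)$ with $i_1=i$, and triggers bells at $(2,i_2),\dots,(s,i_s)$: when the bell on row $r$ rings at $(r,i_r)$, if that site is empty then row $r$ is unchanged and $i_{r+1}=i_r$; if it contains a particle, that particle jumps to the first empty site of row $r$ to its right (cyclically) and $i_{r+1}$ is the column it jumps to. The moves on all rows occur simultaneously. **The map $\Pi:\widehat\Omega_\lambda\to\Omega_\lambda$.** Label the particles of $\hat\eta$ row by row from the top. All particles in row $s$ get label $s$. Once rows $s,\dots,r+1$ are labelled, process the particles of row $r+1$ in decreasing order of label (ties broken arbitrarily, e.g. from left to right): for a row-$(r+1)$ particle in column $j$, look in columns $j,j+1,\dots$ (cyclically) for the first particle in row $r$ not yet matched; match it and give it the same label. When all row-$(r+1)$ particles are processed, every unmatched particle in row $r$ gets label $r$. Finally, vacancies in row $1$ get label $0$. $\Pi(\hat\eta)$ is the sequence of labels in row $1$, read from column $1$ to column $n$. *)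

theory Defs
  imports "HOL-Probability.Probability" "HOL-Combinatorics.Multiset_Permutations"
begin

section \<open>Continuous-time Markov chains on a finite state space\<close>

primrec generator_power :: "'a set \<Rightarrow> ('a \<Rightarrow> 'a \<Rightarrow> real) \<Rightarrow> nat \<Rightarrow> 'a \<Rightarrow> 'a \<Rightarrow> real" where
  "generator_power S Q 0 a b = of_bool (a = b)"
| "generator_power S Q (Suc k) a b = (\<Sum>c\<in>S. Q a c * generator_power S Q k c b)"

text \<open>The entry at \<open>(a, b)\<close> of the matrix exponential \<open>exp (t Q)\<close>, for \<open>Q\<close> an \<open>S \<times> S\<close> matrix
  with \<open>S\<close> finite.\<close>

definition transition_prob :: "'a set \<Rightarrow> ('a \<Rightarrow> 'a \<Rightarrow> real) \<Rightarrow> real \<Rightarrow> 'a \<Rightarrow> 'a \<Rightarrow> real" where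
  "transition_prob S Q t a b = (\<Sum>k. t ^ k / fact k * generator_power S Q k a b)"

text \<open>The process \<open>(X t, t \<ge> 0)\<close> on the probability space \<open>M\<close> is a Markov chain with values in
  the finite set \<open>S\<close> and generator \<open>Q\<close>: its paths are almost surely right-continuous for the
  discrete topology, and its finite-dimensional distributions are those of the semigroup
  \<open>exp (t Q)\<close>. The initial distribution is arbitrary. Values \<open>X t\<close> at \<open>t < 0\<close> are irrelevant.\<close>

definition markov_chain ::
  "'w measure \<Rightarrow> 'a set \<Rightarrow> ('a \<Rightarrow> 'a \<Rightarrow> real) \<Rightarrow> (real \<Rightarrow> 'w \<Rightarrow> 'a) \<Rightarrow> bool" where
  "markov_chain M S Q X \<longleftrightarrow>
     prob_space M \<and>
     (\<forall>t\<ge>0. X t \<in> M \<rightarrow>\<^sub>M count_space S) \<and>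
     (AE \<omega> in M. \<forall>t\<ge>0. \<forall>\<^sub>F u in at_right t. X u \<omega> = X t \<omega>) \<and>
     (\<forall>(k::nat) (t::nat \<Rightarrow> real) (a::nat \<Rightarrow> 'a).
        0 \<le> t 0 \<longrightarrow> (\<forall>i<k. t i \<le> t (Suc i)) \<longrightarrow> (\<forall>i\<le>k. a i \<in> S) \<longrightarrow>
        \<P>(\<omega> in M. \<forall>i\<le>k. X (t i) \<omega> = a i) =
          \<P>(\<omega> in M. X (t 0) \<omega> = a 0) *
          (\<Prod>i<k. transition_prob S Q (t (Suc i) - t i) (a i) (a (Suc i))))"

text \<open>For a Markov chain this says that its initial distribution is invariant.\<close>

definition in_stationarity :: "'w measure \<Rightarrow> 'a set \<Rightarrow> (real \<Rightarrow> 'w \<Rightarrow> 'a) \<Rightarrow> bool" where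
  "in_stationarity M S X \<longleftrightarrow>
     (\<forall>t\<ge>0. distr M (count_space S) (X t) = distr M (count_space S) (X 0))"

text \<open>Generator of the chain in which, independently for each \<open>i < n\<close>, a bell rings at rate
  \<open>1 / x i\<close> and changes the state \<open>a\<close> into \<open>f i a\<close>. The subtracted term produces the diagonal:
  a ring with \<open>f i a = a\<close> contributes nothing.\<close>

definition bell_generator ::
  "nat \<Rightarrow> (nat \<Rightarrow> real) \<Rightarrow> (nat \<Rightarrow> 'a \<Rightarrow> 'a) \<Rightarrow> 'a \<Rightarrow> 'a \<Rightarrow> real" where
  "bell_generator n x f a b = (\<Sum>i<n. 1 / x i * (of_bool (f i a = b) - of_bool (a = b)))"


section \<open>Content and the ring\<close>

text \<open>The content \<open>\<langle>0\<^sup>m\<^sup>0, 1\<^sup>m\<^sup>1, \<dots>, s\<^sup>m\<^sup>s\<rangle>\<close> is given by \<open>s\<close> and \<open>m :: nat \<Rightarrow> nat\<close>; only the values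
  \<open>m 0, \<dots>, m s\<close> matter. Sites of the ring and columns of the array are numbered
  \<open>0, \<dots>, n - 1\<close> instead of \<open>1, \<dots>, n\<close>; rows and species keep their usual numbers.\<close>

definition num_parts :: "nat \<Rightarrow> (nat \<Rightarrow> nat) \<Rightarrow> nat" where
  "num_parts s m = (\<Sum>r\<le>s. m r)"

definition tail_parts :: "nat \<Rightarrow> (nat \<Rightarrow> nat) \<Rightarrow> nat \<Rightarrow> nat" where
  "tail_parts s m r = (\<Sum>q=r..s. m q)"

definition content :: "nat \<Rightarrow> (nat \<Rightarrow> nat) \<Rightarrow> nat multiset" where
  "content s m = (\<Sum>r\<le>s. replicate_mset (m r) r)"

text \<open>The first site among \<open>j, j + 1, \<dots>\<close> (cyclically modulo \<open>n\<close>) satisfying \<open>P\<close>. The site \<open>j\<close>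
  itself is included; in the two dynamics below it never satisfies \<open>P\<close>.\<close>

definition first_site :: "nat \<Rightarrow> nat \<Rightarrow> (nat \<Rightarrow> bool) \<Rightarrow> nat" where
  "first_site n j P = (j + (LEAST d. P ((j + d) mod n))) mod n"


section \<open>The multispecies PushTASEP\<close>

text \<open>Configurations are lists of length \<open>n\<close>: entry \<open>j\<close> is the species at site \<open>j\<close>, with \<open>0\<close> for
  a vacancy.\<close>

definition pushTASEP_states :: "nat \<Rightarrow> (nat \<Rightarrow> nat) \<Rightarrow> nat list set" where
  "pushTASEP_states s m = permutations_of_multiset (content s m)"

text \<open>\<open>displace \<eta> i j\<close>: a particle of species \<open>i\<close>, dislodged from site \<open>j\<close> and not currently
  placed, settles at the first site with an entry below \<open>i\<close>, and so on. For \<open>i = 0\<close> (a vacancy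
  was filled) the guard fails and the cascade ends; for \<open>i > 0\<close> the guard holds whenever \<open>\<eta>\<close>
  has a vacancy.\<close>

function displace :: "nat list \<Rightarrow> nat \<Rightarrow> nat \<Rightarrow> nat list" where
  "displace \<eta> i j =
     (let j' = first_site (length \<eta>) j (\<lambda>k. \<eta> ! k < i); i' = \<eta> ! j'
      in if i' < i then displace (\<eta>[j' := i]) i' j' else \<eta>)"
  by pat_completeness auto
termination
  by (relation "Wellfounded.measure (\<lambda>(\<eta>, i, j). i)") auto

declare displace.simps [simp del]

text \<open>Site \<open>j\<close> keeps its old entry during the cascade, so that no displaced particle can settle
  there, and is vacated at the end.\<close>

definition pushTASEP_bell :: "nat \<Rightarrow> nat list \<Rightarrow> nat list" where
  "pushTASEP_bell j \<eta> = (displace \<eta> (\<eta> ! j) j)[j := 0]"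

definition pushTASEP ::
  "'w measure \<Rightarrow> nat \<Rightarrow> (nat \<Rightarrow> nat) \<Rightarrow> (nat \<Rightarrow> real) \<Rightarrow> (real \<Rightarrow> 'w \<Rightarrow> nat list) \<Rightarrow> bool" where
  "pushTASEP M s m x X \<longleftrightarrow>
     markov_chain M (pushTASEP_states s m) (bell_generator (num_parts s m) x pushTASEP_bell) X"


section \<open>The multiline process\<close>

text \<open>A multiline diagram is the set of its occupied positions \<open>(row, column)\<close>.\<close>

type_synonym multiline = "(nat \<times> nat) set"

definition multiline_states :: "nat \<Rightarrow> (nat \<Rightarrow> nat) \<Rightarrow> multiline set" where
  "multiline_states s m =
     {C. C \<subseteq> {1..s} \<times> {..<num_parts s m} \<and>
         (\<forall>r\<in>{1..s}. card {k. (r, k) \<in> C} = tail_parts s m r)}"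

text \<open>Ring the bell at column \<open>i\<close> of row \<open>r\<close>; the second component of the result is the column
  at which the bell on row \<open>r + 1\<close> rings.\<close>

definition row_bell :: "nat \<Rightarrow> nat \<Rightarrow> multiline \<times> nat \<Rightarrow> multiline \<times> nat" where
  "row_bell n r = (\<lambda>(C, i).
     if (r, i) \<in> C
     then let i' = first_site n i (\<lambda>k. (r, k) \<notin> C) in (insert (r, i') (C - {(r, i)}), i')
     else (C, i))"

definition multiline_bell :: "nat \<Rightarrow> nat \<Rightarrow> nat \<Rightarrow> multiline \<Rightarrow> multiline" where
  "multiline_bell n s i C = fst (fold (row_bell n) [1..<Suc s] (C, i))"

definition multiline_process ::
  "'w measure \<Rightarrow> nat \<Rightarrow> (nat \<Rightarrow> nat) \<Rightarrow> (nat \<Rightarrow> real) \<Rightarrow> (real \<Rightarrow> 'w \<Rightarrow> multiline) \<Rightarrow> bool" where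
  "multiline_process M s m x X \<longleftrightarrow>
     markov_chain M (multiline_states s m)
       (bell_generator (num_parts s m) x (multiline_bell (num_parts s m) s)) X"


section \<open>The projection\<close>

text \<open>The particles of row \<open>r + 1\<close>, whose labels are given by \<open>L\<close>, in decreasing order of label.
  Since \<^const>\<open>sort_key\<close> is stable, ties are broken from left to right.\<close>

definition matching_order :: "nat \<Rightarrow> multiline \<Rightarrow> nat \<Rightarrow> nat list \<Rightarrow> nat list" where
  "matching_order n C r L = sort_key (\<lambda>j. - int (L ! j)) (filter (\<lambda>j. (Suc r, j) \<in> C) [0..<n])"

text \<open>Match the particle of row \<open>r + 1\<close> in column \<open>j\<close>. The state consists of the columns of the
  particles of row \<open>r\<close> not yet matched and of the current labels of row \<open>r\<close>.\<close>

definition match_particle ::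
  "nat \<Rightarrow> nat list \<Rightarrow> nat \<Rightarrow> nat set \<times> nat list \<Rightarrow> nat set \<times> nat list" where
  "match_particle n L j = (\<lambda>(U, L').
     let k = first_site n j (\<lambda>k. k \<in> U) in (U - {k}, L'[k := L ! j]))"

text \<open>The labels of row \<open>r\<close> (with \<open>0\<close> for vacancies) from the labels \<open>L\<close> of row \<open>r + 1\<close>. All
  particles of row \<open>r\<close> start with label \<open>r\<close>, which the unmatched ones keep.\<close>

definition label_row :: "nat \<Rightarrow> multiline \<Rightarrow> nat \<Rightarrow> nat list \<Rightarrow> nat list" where
  "label_row n C r L =
     snd (fold (match_particle n L) (matching_order n C r L)
       ({k. (r, k) \<in> C}, map (\<lambda>k. if (r, k) \<in> C then r else 0) [0..<n]))"

text \<open>Rows are labelled in the order \<open>s, \<dots>, 1\<close>, starting from an empty row \<open>s + 1\<close>, so that all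
  particles of row \<open>s\<close> are unmatched and get label \<open>s\<close>.\<close>

definition multiline_projection :: "nat \<Rightarrow> nat \<Rightarrow> multiline \<Rightarrow> nat list" where
  "multiline_projection n s C = foldr (label_row n C) [1..<Suc s] (replicate n 0)"

end

theory Submission
  imports Defs
begin

text \<open>
  The projection intertwines the two dynamics deterministically: ringing the bell at \<open>i\<close> in the
  diagram and then projecting is the same as projecting and then ringing the bell at \<open>i\<close>. Hence the
  projected chain is Markov by strong lumpability, from any initial distribution.

  For the intertwining, a configuration is replaced by its superlevel sets \<open>{k. L ! k \<ge> q}\<close>. On these
  a bell of the PushTASEP acts as the one-species dynamics, and one row of the labelling acts
  as a discrete-time queue on the ring, with arrivals from the row above, services at the
  particles of the current row, and departures at the sites labelled at least \<open>q\<close>. The departure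
  set is determined by the existence of a periodic queue-length function, so the statement for
  a single row reduces to exhibiting the queue lengths after the bell: they are the old ones,
  plus one where a displaced departure is in transit, minus one where a displaced arrival is.
\<close>

section \<open>Arcs and queues on the ring\<close>

lemma bij_betw_Suc_mod: "bij_betw (\<lambda>k. Suc k mod n) {..<n} {..<n}"
proof (cases "n = 0")
  case False
  have "inj_on (\<lambda>k. Suc k mod n) {..<n}"
    by (auto simp: inj_on_def mod_Suc split: if_splits)
  moreover have "(\<lambda>k. Suc k mod n) ` {..<n} \<subseteq> {..<n}"
    using False by auto
  ultimately show ?thesis
    by (simp add: bij_betw_def endo_inj_surj)
qed simp

text \<open>Differences \<open>f (Suc k mod n) - f k\<close> cancel around the ring; conservation of
  customers rests on this.\<close>

lemma sum_Suc_mod: "(\<Sum>k<n. f (Suc k mod n)) = (\<Sum>k<n. f k)"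
  using sum.reindex_bij_betw[OF bij_betw_Suc_mod] by blast

text \<open>\<open>V\<close> is the arc of the sites after \<open>i\<close> up to and including the
  first one satisfying \<open>P\<close>, empty if \<open>i\<close> itself does. Presenting it by a
  successor rule and an induction principle keeps arguments about moving particles local: they only
  compare \<open>k\<close> with \<open>Suc k mod n\<close>.\<close>

lemma first_site_arc:
  fixes n i :: nat
  assumes "i < n" "\<exists>k<n. P k"
  obtains V where
    "first_site n i P < n" "P (first_site n i P)"
    "\<And>k. k \<in> V \<Longrightarrow> k < n"
    "i \<notin> V"
    "\<And>k. k \<in> V \<Longrightarrow> k \<noteq> first_site n i P \<Longrightarrow> \<not> P k"
    "\<And>k. k < n \<Longrightarrow> Suc k mod n \<in> V \<longleftrightarrow>
       (k = i \<and> i \<noteq> first_site n i P) \<or> (k \<in> V \<and> k \<noteq> first_site n i P)"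
    "\<forall>Q. (i \<noteq> first_site n i P \<longrightarrow> Q (Suc i mod n)) \<longrightarrow>
       (\<forall>k. k \<in> V \<longrightarrow> k \<noteq> first_site n i P \<longrightarrow> Q k \<longrightarrow> Q (Suc k mod n)) \<longrightarrow> (\<forall>k. k \<in> V \<longrightarrow> Q k)"
    "i = first_site n i P \<longleftrightarrow> P i"
    "first_site n i P \<in> insert i V"
proof -
  define j where "j = first_site n i P"
  define d where "d = (LEAST d. P ((i + d) mod n))"
  define pos where "pos e = (i + e) mod n" for e
  obtain k where k: "k < n" "P k" using assms by blast
  \<comment> \<open>The clockwise distance from \<open>i\<close> to \<open>k\<close>; it shows that
    the least offset \<open>d\<close> exists and is below \<open>n\<close>.\<close>
  define e0 where "e0 = (if i \<le> k then k - i else n + k - i)"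
  have e0: "e0 < n" "pos e0 = k"
    using assms(1) k by (auto simp: e0_def pos_def)
  have Pd: "P (pos d)"
    unfolding d_def pos_def by (rule LeastI[of _ e0]) (use e0 k in \<open>simp add: pos_def\<close>)
  have dl: "\<not> P (pos e)" if "e < d" for e
    using not_less_Least that unfolding d_def pos_def by blast
  have dn: "d < n"
    using dl[of e0] e0 k by (meson leI le_less_trans)
  have j: "j = pos d" by (simp add: j_def first_site_def d_def pos_def)
  \<comment> \<open>Offsets below \<open>n\<close> name distinct sites, so the arc does not wrap
    onto itself.\<close>
  have inj: "e = e'" if "pos e = pos e'" "e < n" "e' < n" for e e'
  proof -
    have *: "pos e = (if i + e < n then i + e else i + e - n)" if "e < n" for e
      using that assms(1) by (auto simp: pos_def mod_if)
    show ?thesis using that assms(1) by (auto simp: * split: if_splits)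
  qed
  have pos0: "pos 0 = i" using assms(1) by (simp add: pos_def)
  have posS: "pos (Suc e) = Suc (pos e) mod n" for e
    by (simp add: pos_def mod_Suc_eq)
  have posn: "pos e < n" for e using assms(1) by (simp add: pos_def)
  define V where "V = pos ` {1..d}"
  have 1: "j < n" "P j" using posn Pd j by auto
  have 2: "k < n" if "k \<in> V" for k using that posn by (auto simp: V_def)
  have 3: "i \<notin> V"
    using inj[of 0] dn pos0 by (fastforce simp: V_def)
  have 4: "\<not> P k" if kV: "k \<in> V" and kj: "k \<noteq> j" for k
  proof -
    obtain e where "1 \<le> e" "e \<le> d" "k = pos e" using kV by (auto simp: V_def)
    then show ?thesis using dl[of e] kj j by (cases "e = d") auto
  qed
  have ij: "i = j \<longleftrightarrow> d = 0"
    using inj[of 0 d] dn pos0 j by auto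
  have 5: "Suc k mod n \<in> V \<longleftrightarrow> (k = i \<and> i \<noteq> j) \<or> (k \<in> V \<and> k \<noteq> j)" if "k < n" for k
  proof
    assume "Suc k mod n \<in> V"
    then obtain e' where e': "e' \<in> {1..d}" "Suc k mod n = pos e'"
      unfolding V_def by blast
    define e where "e = e' - 1"
    have e: "e < d" "Suc k mod n = pos (Suc e)" using e' by (auto simp: e_def)
    then have "Suc k mod n = Suc (pos e) mod n" by (simp add: posS)
    then have k: "k = pos e"
      using bij_betw_imp_inj_on[OF bij_betw_Suc_mod[of n]] that posn[of e] by (auto dest: inj_onD)
    show "(k = i \<and> i \<noteq> j) \<or> (k \<in> V \<and> k \<noteq> j)"
    proof (cases "e = 0")
      case True then show ?thesis using k pos0 ij e(1) by auto
    next
      case False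
      then have "k \<in> V" unfolding V_def k using e(1) by (intro imageI) simp
      moreover have "k \<noteq> j" using inj[of e d] dn e(1) k j by auto
      ultimately show ?thesis by simp
    qed
  next
    assume "(k = i \<and> i \<noteq> j) \<or> (k \<in> V \<and> k \<noteq> j)"
    then obtain e where "e < d" "k = pos e"
    proof
      assume "k = i \<and> i \<noteq> j"
      then show ?thesis using that[of 0] ij pos0 by simp
    next
      assume "k \<in> V \<and> k \<noteq> j"
      then obtain e where "e \<in> {1..d}" "k = pos e" "k \<noteq> j" unfolding V_def by blast
      then show ?thesis using that[of e] j by (cases "e = d") auto
    qed
    then show "Suc k mod n \<in> V"
      unfolding V_def by (intro image_eqI[of _ _ "Suc e"]) (auto simp: posS)
  qed
  have 6: "Q k" if Q0: "i \<noteq> j \<Longrightarrow> Q (Suc i mod n)"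
    and QS: "\<And>k. k \<in> V \<Longrightarrow> k \<noteq> j \<Longrightarrow> Q k \<Longrightarrow> Q (Suc k mod n)" and kV: "k \<in> V" for Q k
  proof -
    have "Q (pos (Suc e))" if "Suc e \<le> d" for e
      using that
    proof (induction e)
      case 0
      then show ?case using Q0 ij pos0 posS[of 0] by simp
    next
      case (Suc e)
      have "pos (Suc e) \<noteq> j" using inj[of "Suc e" d] dn Suc.prems j by auto
      moreover have "pos (Suc e) \<in> V" unfolding V_def using Suc.prems by (intro imageI) simp
      ultimately show ?case using QS Suc posS by simp
    qed
    moreover obtain e where "e \<in> {1..d}" "k = pos e" using kV unfolding V_def by blast
    ultimately show ?thesis by (cases e) auto
  qed
  have 7: "i = j \<longleftrightarrow> P i"
    using ij dl[of 0] pos0 1 by auto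
  have 8: "j \<in> insert i V"
    using j pos0 by (cases "d = 0") (auto simp: V_def)
  show thesis
  proof (rule that[of V], unfold j_def[symmetric])
    show "\<forall>Q. (i \<noteq> j \<longrightarrow> Q (Suc i mod n)) \<longrightarrow>
       (\<forall>k. k \<in> V \<longrightarrow> k \<noteq> j \<longrightarrow> Q k \<longrightarrow> Q (Suc k mod n)) \<longrightarrow> (\<forall>k. k \<in> V \<longrightarrow> Q k)"
      using 6 by blast
  qed (use 1 2 3 4 5 7 8 in auto)
qed

text \<open>Arrivals \<open>B\<close>, services \<open>A\<close>, departures \<open>D\<close>; \<open>q k\<close> is the queue length just before site \<open>k\<close>,
  where an arrival precedes the service. The queue may be nonempty everywhere, so \<open>q\<close> itself is
  not unique when \<open>A\<close> and \<open>B\<close> have the same size.\<close>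

definition queue :: "nat \<Rightarrow> nat set \<Rightarrow> nat set \<Rightarrow> nat set \<Rightarrow> bool" where
  "queue n A B D \<longleftrightarrow> D \<subseteq> {..<n} \<and> (\<exists>q :: nat \<Rightarrow> int. \<forall>k<n. q k \<ge> 0 \<and>
     q (Suc k mod n) = q k + of_bool (k \<in> B) - of_bool (k \<in> D) \<and>
     (k \<in> D \<longleftrightarrow> k \<in> A \<and> q k + of_bool (k \<in> B) > 0))"

text \<open>The distance of two queue-length functions never increases along the ring, hence is
  constant, and a site where only one of them has a departure would decrease it.\<close>

lemma queue_unique:
  assumes "queue n A B D" "queue n A B D'"
  shows "D = D'"
proof -
  obtain q where D: "D \<subseteq> {..<n}" and q: "\<And>k. k < n \<Longrightarrow> q k \<ge> (0::int) \<and>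
     q (Suc k mod n) = q k + of_bool (k \<in> B) - of_bool (k \<in> D) \<and>
     (k \<in> D \<longleftrightarrow> k \<in> A \<and> q k + of_bool (k \<in> B) > 0)"
    using assms(1) unfolding queue_def by blast
  obtain q' where D': "D' \<subseteq> {..<n}" and q': "\<And>k. k < n \<Longrightarrow> q' k \<ge> (0::int) \<and>
     q' (Suc k mod n) = q' k + of_bool (k \<in> B) - of_bool (k \<in> D') \<and>
     (k \<in> D' \<longleftrightarrow> k \<in> A \<and> q' k + of_bool (k \<in> B) > 0)"
    using assms(2) unfolding queue_def by blast
  define e where "e k = \<bar>q k - q' k\<bar>" for k
  have le: "e k - e (Suc k mod n) \<ge> 0" if "k < n" for k
    using q[OF that] q'[OF that] unfolding e_def
    by (auto simp: of_bool_def split: if_splits)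
  have "(\<Sum>k<n. e k - e (Suc k mod n)) = 0"
    by (simp add: sum_subtractf sum_Suc_mod)
  then have z: "\<forall>k\<in>{..<n}. e k - e (Suc k mod n) = 0"
    using le by (subst sum_nonneg_eq_0_iff[symmetric]) auto
  have eq: "e (Suc k mod n) = e k" if "k < n" for k
    using bspec[OF z, of k] that by simp
  have "k \<in> D \<longleftrightarrow> k \<in> D'" if "k < n" for k
    using q[OF that] q'[OF that] eq[OF that] unfolding e_def
    by (cases "k \<in> D"; cases "k \<in> D'"; cases "k \<in> B"; cases "k \<in> A"; simp; linarith?)
  then show ?thesis using D D' by blast
qed

text \<open>Summed around the ring, the queue lengths cancel from the balance equation, which leaves
  one departure per arrival.\<close>

lemma queue_card:
  assumes "queue n A B D" "B \<subseteq> {..<n}"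
  shows "card D = card B"
proof -
  obtain q where D: "D \<subseteq> {..<n}" and q: "\<And>k. k < n \<Longrightarrow>
     q (Suc k mod n) = q k + of_bool (k \<in> B) - (of_bool (k \<in> D) :: int)"
    using assms(1) unfolding queue_def by blast
  have "(\<Sum>k<n. q (Suc k mod n)) = (\<Sum>k<n. q k + of_bool (k \<in> B) - of_bool (k \<in> D))"
    using q by (intro sum.cong) auto
  then have "(\<Sum>k<n. of_bool (k \<in> B)) = (\<Sum>k<n. of_bool (k \<in> D) :: int)"
    by (simp add: sum_Suc_mod sum.distrib sum_subtractf)
  moreover have "(\<Sum>k<n. of_bool (k \<in> E) :: int) = int (card E)" if "E \<subseteq> {..<n}" for E
    using that by (simp add: of_bool_def sum.If_cases Int_absorb1)
  ultimately show ?thesis using D assms(2) by simp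
qed

lemma queue_empty: "queue n A {} {}"
  unfolding queue_def by (auto intro!: exI[of _ "\<lambda>_. 0"])

text \<open>The new customer finds every service before \<open>k'\<close> taken, waits, and leaves
  at \<open>k'\<close>, while earlier departures stay as they are. This is why matching particles
  one at a time builds up the departure set.\<close>

lemma queue_insert:
  assumes "queue n A B D" "j < n" "j \<notin> B" "\<exists>k<n. k \<in> A - D"
  defines "k' \<equiv> first_site n j (\<lambda>k. k \<in> A - D)"
  shows "queue n A (insert j B) (insert k' D)"
proof -
  obtain q where D: "D \<subseteq> {..<n}" and q: "\<And>k. k < n \<Longrightarrow> q k \<ge> (0::int) \<and>
     q (Suc k mod n) = q k + of_bool (k \<in> B) - of_bool (k \<in> D) \<and>
     (k \<in> D \<longleftrightarrow> k \<in> A \<and> q k + of_bool (k \<in> B) > 0)"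
    using assms(1) unfolding queue_def by blast
  obtain V where V: "k' < n" "k' \<in> A - D" "\<And>k. k \<in> V \<Longrightarrow> k < n" "j \<notin> V"
    "\<And>k. k \<in> V \<Longrightarrow> k \<noteq> k' \<Longrightarrow> k \<notin> A - D"
    "\<And>k. k < n \<Longrightarrow> Suc k mod n \<in> V \<longleftrightarrow> (k = j \<and> j \<noteq> k') \<or> (k \<in> V \<and> k \<noteq> k')"
    "\<forall>Q. (j \<noteq> k' \<longrightarrow> Q (Suc j mod n)) \<longrightarrow>
       (\<forall>k. k \<in> V \<longrightarrow> k \<noteq> k' \<longrightarrow> Q k \<longrightarrow> Q (Suc k mod n)) \<longrightarrow> (\<forall>k. k \<in> V \<longrightarrow> Q k)"
    "j = k' \<longleftrightarrow> j \<in> A - D" "k' \<in> insert j V"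
    by (rule first_site_arc[OF assms(2,4), folded k'_def]) (rule that)
  \<comment> \<open>The extra customer is in the queue exactly on the arc after \<open>j\<close> up
    to \<open>k'\<close>; the arc is empty if the service at \<open>j\<close> itself is
    free.\<close>
  define q' where "q' k = q k + of_bool (k \<in> V)" for k
  have "q' k \<ge> 0 \<and> q' (Suc k mod n) = q' k + of_bool (k \<in> insert j B) - of_bool (k \<in> insert k' D) \<and>
     (k \<in> insert k' D \<longleftrightarrow> k \<in> A \<and> q' k + of_bool (k \<in> insert j B) > 0)" if k: "k < n" for k
    using q[OF k] V(1,2,4,8,9) V(5)[of k] V(6)[OF k] assms(3) unfolding q'_def insert_iff Diff_iff of_bool_def
    by (smt (verit))
  then show ?thesis
    unfolding queue_def using D V(1) by (intro conjI exI[of _ q'] allI impI) blast+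
qed

section \<open>One-species push dynamics and its action on queues\<close>

text \<open>The occupied sites after a bell at \<open>i\<close> in the PushTASEP with one species;
  equally, one row of the diagram after its bell.\<close>

definition push_set :: "nat \<Rightarrow> nat \<Rightarrow> nat set \<Rightarrow> nat set" where
  "push_set n i B = (if i \<in> B then insert (first_site n i (\<lambda>k. k \<notin> B)) (B - {i}) else B)"

text \<open>The column at which the next row up is rung. For \<open>i < n\<close> both branches give
  the first site outside \<open>B\<close> counted from \<open>i\<close> itself.\<close>

definition push_target :: "nat \<Rightarrow> nat \<Rightarrow> nat set \<Rightarrow> nat" where
  "push_target n i B = (if i \<in> B then first_site n i (\<lambda>k. k \<notin> B) else i)"

lemma first_site_self: "i < n \<Longrightarrow> P i \<Longrightarrow> first_site n i P = i"
  by (simp add: first_site_def)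

text \<open>Because \<open>push_target\<close> is the first site outside \<open>B\<close> in either
  case, \<open>first_site_arc\<close> covers both; the arc is empty when nothing moves.\<close>

lemma push_arc:
  assumes "i < n" "\<exists>k<n. k \<notin> B"
  obtains V where
    "push_target n i B < n" "push_target n i B \<notin> B"
    "i \<notin> V"
    "\<And>k. k \<in> V \<Longrightarrow> k \<noteq> push_target n i B \<Longrightarrow> k \<in> B"
    "\<And>k. k < n \<Longrightarrow> Suc k mod n \<in> V \<longleftrightarrow> (k = i \<and> i \<in> B) \<or> (k \<in> V \<and> k \<noteq> push_target n i B)"
    "\<forall>Q. (i \<in> B \<longrightarrow> Q (Suc i mod n)) \<longrightarrow>
       (\<forall>k. k \<in> V \<longrightarrow> k \<noteq> push_target n i B \<longrightarrow> Q k \<longrightarrow> Q (Suc k mod n)) \<longrightarrow> (\<forall>k. k \<in> V \<longrightarrow> Q k)"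
    "push_target n i B \<in> V \<longleftrightarrow> i \<in> B"
    "\<And>k. k \<in> push_set n i B \<longleftrightarrow> (k \<in> B \<and> k \<noteq> i) \<or> (k = push_target n i B \<and> i \<in> B)"
    "\<And>k. k \<in> V \<Longrightarrow> k < n"
proof -
  define j where "j = first_site n i (\<lambda>k. k \<notin> B)"
  have t: "push_target n i B = j"
    using first_site_self[of i n "\<lambda>k. k \<notin> B"] assms(1) by (auto simp: push_target_def j_def)
  obtain V where V: "j < n" "j \<notin> B" "\<And>k. k \<in> V \<Longrightarrow> k < n" "i \<notin> V"
    "\<And>k. k \<in> V \<Longrightarrow> k \<noteq> j \<Longrightarrow> \<not> (k \<notin> B)"
    "\<And>k. k < n \<Longrightarrow> Suc k mod n \<in> V \<longleftrightarrow> (k = i \<and> i \<noteq> j) \<or> (k \<in> V \<and> k \<noteq> j)"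
    "\<forall>Q. (i \<noteq> j \<longrightarrow> Q (Suc i mod n)) \<longrightarrow>
       (\<forall>k. k \<in> V \<longrightarrow> k \<noteq> j \<longrightarrow> Q k \<longrightarrow> Q (Suc k mod n)) \<longrightarrow> (\<forall>k. k \<in> V \<longrightarrow> Q k)"
    "i = j \<longleftrightarrow> i \<notin> B" "j \<in> insert i V"
    by (rule first_site_arc[OF assms, folded j_def]) (rule that)
  show thesis
  proof (rule that[of V], unfold t)
    show "\<forall>Q. (i \<in> B \<longrightarrow> Q (Suc i mod n)) \<longrightarrow>
       (\<forall>k. k \<in> V \<longrightarrow> k \<noteq> j \<longrightarrow> Q k \<longrightarrow> Q (Suc k mod n)) \<longrightarrow> (\<forall>k. k \<in> V \<longrightarrow> Q k)"
      using V(7) by (simp add: V(8))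
    show "k \<in> push_set n i B \<longleftrightarrow> (k \<in> B \<and> k \<noteq> i) \<or> (k = j \<and> i \<in> B)" for k
      by (auto simp: push_set_def j_def)
  qed (use V in auto)
qed

text \<open>Services and departures are rung at \<open>i\<close>, arrivals only where the moved
  service lands. The queue lengths change on the arcs \<open>U\<close> of the moved departure and
  \<open>V\<close> of the moved arrival; the arc \<open>W\<close> of the moved service ties the two
  together.\<close>

lemma queue_push:
  assumes "queue n A B D" "i < n" "\<exists>k<n. k \<notin> A" "\<exists>k<n. k \<notin> B"
  shows "queue n (push_set n i A) (push_set n (push_target n i A) B) (push_set n i D)"
proof -
  obtain q where D: "D \<subseteq> {..<n}" and q: "\<And>k. k < n \<Longrightarrow> q k \<ge> (0::int) \<and>
     q (Suc k mod n) = q k + of_bool (k \<in> B) - of_bool (k \<in> D) \<and>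
     (k \<in> D \<longleftrightarrow> k \<in> A \<and> q k + of_bool (k \<in> B) > 0)"
    using assms(1) unfolding queue_def by blast
  then have q0: "q k \<ge> 0" and qS: "q (Suc k mod n) = q k + of_bool (k \<in> B) - of_bool (k \<in> D)"
    and qD: "k \<in> D \<longleftrightarrow> k \<in> A \<and> q k + of_bool (k \<in> B) > 0" if "k < n" for k
    using that by blast+
  define i' where "i' = push_target n i A"
  define i'' where "i'' = push_target n i' B"
  define j where "j = push_target n i D"
  obtain W where W: "i' < n" "i' \<notin> A" "i \<notin> W"
    "\<And>k. k \<in> W \<Longrightarrow> k \<noteq> i' \<Longrightarrow> k \<in> A"
    "\<And>k. k < n \<Longrightarrow> Suc k mod n \<in> W \<longleftrightarrow> (k = i \<and> i \<in> A) \<or> (k \<in> W \<and> k \<noteq> i')"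
    "\<forall>Q. (i \<in> A \<longrightarrow> Q (Suc i mod n)) \<longrightarrow>
       (\<forall>k. k \<in> W \<longrightarrow> k \<noteq> i' \<longrightarrow> Q k \<longrightarrow> Q (Suc k mod n)) \<longrightarrow> (\<forall>k. k \<in> W \<longrightarrow> Q k)"
    "i' \<in> W \<longleftrightarrow> i \<in> A"
    "\<And>k. k \<in> push_set n i A \<longleftrightarrow> (k \<in> A \<and> k \<noteq> i) \<or> (k = i' \<and> i \<in> A)"
    "\<And>k. k \<in> W \<Longrightarrow> k < n"
    by (rule push_arc[OF assms(2,3), folded i'_def]) (rule that)
  obtain V where V: "i'' < n" "i'' \<notin> B" "i' \<notin> V"
    "\<And>k. k \<in> V \<Longrightarrow> k \<noteq> i'' \<Longrightarrow> k \<in> B"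
    "\<And>k. k < n \<Longrightarrow> Suc k mod n \<in> V \<longleftrightarrow> (k = i' \<and> i' \<in> B) \<or> (k \<in> V \<and> k \<noteq> i'')"
    "\<forall>Q. (i' \<in> B \<longrightarrow> Q (Suc i' mod n)) \<longrightarrow>
       (\<forall>k. k \<in> V \<longrightarrow> k \<noteq> i'' \<longrightarrow> Q k \<longrightarrow> Q (Suc k mod n)) \<longrightarrow> (\<forall>k. k \<in> V \<longrightarrow> Q k)"
    "i'' \<in> V \<longleftrightarrow> i' \<in> B"
    "\<And>k. k \<in> push_set n i' B \<longleftrightarrow> (k \<in> B \<and> k \<noteq> i') \<or> (k = i'' \<and> i' \<in> B)"
    "\<And>k. k \<in> V \<Longrightarrow> k < n"
    by (rule push_arc[OF W(1) assms(4), folded i''_def]) (rule that)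
  have Dn: "\<exists>k<n. k \<notin> D" using assms(3) qD by blast
  obtain U where U: "j < n" "j \<notin> D" "i \<notin> U"
    "\<And>k. k \<in> U \<Longrightarrow> k \<noteq> j \<Longrightarrow> k \<in> D"
    "\<And>k. k < n \<Longrightarrow> Suc k mod n \<in> U \<longleftrightarrow> (k = i \<and> i \<in> D) \<or> (k \<in> U \<and> k \<noteq> j)"
    "\<forall>Q. (i \<in> D \<longrightarrow> Q (Suc i mod n)) \<longrightarrow>
       (\<forall>k. k \<in> U \<longrightarrow> k \<noteq> j \<longrightarrow> Q k \<longrightarrow> Q (Suc k mod n)) \<longrightarrow> (\<forall>k. k \<in> U \<longrightarrow> Q k)"
    "j \<in> U \<longleftrightarrow> i \<in> D"
    "\<And>k. k \<in> push_set n i D \<longleftrightarrow> (k \<in> D \<and> k \<noteq> i) \<or> (k = j \<and> i \<in> D)"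
    "\<And>k. k \<in> U \<Longrightarrow> k < n"
    by (rule push_arc[OF assms(2) Dn, folded j_def]) (rule that)
  \<comment> \<open>There is no service at \<open>i'\<close>, so an arrival there has to wait;
    before \<open>i''\<close> each site of \<open>V\<close> brings a new arrival, so the queue
    cannot run empty.\<close>
  have qV: "q k \<ge> 1" if "k \<in> V" for k
    using that
  proof (rule V(6)[rule_format, rotated 2])
    show "q (Suc i' mod n) \<ge> 1" if "i' \<in> B"
      using qS[OF W(1)] q0[OF W(1)] qD[OF W(1)] that W(2) by simp
    show "q (Suc k mod n) \<ge> 1" if "k \<in> V" "k \<noteq> i''" "q k \<ge> 1" for k
      using that qS[of k] V(4,9)[of k] by simp
  qed
  \<comment> \<open>Departures only occur at services, so going clockwise from \<open>i\<close> a
    site outside \<open>D\<close> is met no later than one outside \<open>A\<close>.\<close>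
  have UW: "k \<in> W" if "k \<in> U" for k
    using that
  proof (rule U(6)[rule_format, rotated 2])
    show "Suc i mod n \<in> W" if "i \<in> D"
      using that W(5) qD assms(2) by blast
    show "Suc k mod n \<in> W" if "k \<in> U" "k \<noteq> j" "k \<in> W" for k
      using that W(2,5) U(4,9) qD by blast
  qed
  have qW: "k \<in> U \<or> q k = 0" if "k \<in> W" for k
    using that
  proof (rule W(6)[rule_format, rotated 2])
    show "Suc i mod n \<in> U \<or> q (Suc i mod n) = 0" if "i \<in> A"
      using that U(5)[OF assms(2)] qS[OF assms(2)] qD[OF assms(2)] q0[OF assms(2)] by auto
    show "Suc k mod n \<in> U \<or> q (Suc k mod n) = 0"
      if "k \<in> W" "k \<noteq> i'" "k \<in> U \<or> q k = 0" for k
      using that W(4,9)[of k] U(2) U(5)[of k] qS[of k] qD[of k] q0[of k] by (cases "k \<in> B") auto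
  qed
  \<comment> \<open>The moved departure stays in the queue along \<open>U\<close>, the moved arrival
    is missing along \<open>V\<close>; \<open>qV\<close> keeps the difference nonnegative. What
    remains is a case distinction at a single site.\<close>
  define q' where "q' k = q k + of_bool (k \<in> U) - of_bool (k \<in> V)" for k
  have "q' k \<ge> 0 \<and>
     q' (Suc k mod n) = q' k + of_bool (k \<in> push_set n i' B) - of_bool (k \<in> push_set n i D) \<and>
     (k \<in> push_set n i D \<longleftrightarrow> k \<in> push_set n i A \<and> q' k + of_bool (k \<in> push_set n i' B) > 0)"
    if k: "k < n" for k
    using q0[OF k] qS[OF k] qD[OF k] W(2,3,7) V(2,3,7) U(2,3,7) W(4,5)[of k] V(4,5)[of k] U(4,5)[of k]
      qV[of k] UW[of k] qW[of k] k
    unfolding q'_def W(8) V(8) U(8) of_bool_def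
    by (smt (verit))
  then show ?thesis
    unfolding queue_def i'_def[symmetric] using D U(1) U(8) by (intro conjI exI[of _ q'] allI impI) blast+
qed

section \<open>Superlevel sets of the labels\<close>

lemma first_site_cong:
  assumes "n > 0" "\<And>k. k < n \<Longrightarrow> P k \<longleftrightarrow> Q k"
  shows "first_site n j P = first_site n j Q"
  using assms by (simp add: first_site_def)

lemma first_site_ex:
  assumes "j < n" "\<exists>k<n. P k"
  shows "first_site n j P < n" "P (first_site n j P)"
  by (rule first_site_arc[OF assms], assumption)+

text \<open>No site satisfying \<open>Q\<close> precedes the first one satisfying the weaker
  \<open>P\<close>, so the search may pause there. In a cascade the pauses are the intermediate
  stops.\<close>

lemma first_site_first_site:
  assumes "j < n" "\<exists>k<n. Q k" "\<And>k. Q k \<Longrightarrow> P k"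
  shows "first_site n (first_site n j P) Q = first_site n j Q"
proof -
  define d where "d = (LEAST d. P ((j + d) mod n))"
  define e where "e = (LEAST d. Q ((j + d) mod n))"
  obtain k where k: "k < n" "Q k" using assms by blast
  have ex: "Q ((j + (if j \<le> k then k - j else n + k - j)) mod n)"
    using assms(1) k by auto
  have Qe: "Q ((j + e) mod n)"
    unfolding e_def by (rule LeastI, rule ex)
  have eL: "e \<le> d'" if "Q ((j + d') mod n)" for d'
    unfolding e_def using that by (rule Least_le)
  have de: "d \<le> e"
    unfolding d_def using assms(3)[OF Qe] by (rule Least_le)
  have m: "((j + d) mod n + f) mod n = (j + (d + f)) mod n" for f
    by (simp add: mod_add_left_eq add.assoc)
  have "(LEAST f. Q ((j + (d + f)) mod n)) = e - d"
  proof (rule Least_equality)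
    show "Q ((j + (d + (e - d))) mod n)" using Qe de by simp
    show "e - d \<le> f" if "Q ((j + (d + f)) mod n)" for f
      using eL[OF that] by simp
  qed
  then show ?thesis
    unfolding first_site_def d_def[symmetric] e_def[symmetric] m using de by simp
qed

definition level :: "nat list \<Rightarrow> nat \<Rightarrow> nat set" where
  "level L q = {k. k < length L \<and> q \<le> L ! k}"

lemma level_subset: "level L q \<subseteq> {..<length L}"
  by (auto simp: level_def)

text \<open>An entry is the largest threshold whose level contains its site, and 0 if no positive
  one does; so thresholds from 1 on suffice.\<close>

lemma list_eq_level:
  assumes "length L = length L'" "\<And>q. q \<ge> 1 \<Longrightarrow> level L q = level L' q"
  shows "L = L'"
proof (rule nth_equalityI[OF assms(1)])
  fix k assume k: "k < length L"
  have *: "q \<le> L ! k \<longleftrightarrow> q \<le> L' ! k" if "q \<ge> 1" for q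
    using assms(2)[OF that] k assms(1) by (auto simp: level_def)
  show "L ! k = L' ! k"
    using *[of "L ! k"] *[of "L' ! k"] by (cases "L ! k = 0"; cases "L' ! k = 0") auto
qed

section \<open>Superlevel sets under a PushTASEP bell\<close>

text \<open>At threshold \<open>q\<close>, displacing an entry that is at least \<open>q\<close> is
  invisible, since the new entry is larger still. The only visible move puts a particle of species
  at least \<open>q\<close> on an entry below \<open>q\<close>, and by
  \<open>first_site_first_site\<close> this happens at the first such site from \<open>j\<close> on.
  Species decrease along the cascade, so nothing is visible if \<open>i\<close> is already below
  \<open>q\<close>.\<close>

lemma level_displace:
  assumes "j < length \<eta>" "i > 0 \<Longrightarrow> \<exists>k<length \<eta>. \<eta> ! k = 0" "q \<ge> 1"
  shows "length (displace \<eta> i j) = length \<eta> \<and> level (displace \<eta> i j) q =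
    (if q \<le> i then insert (first_site (length \<eta>) j (\<lambda>k. \<eta> ! k < q)) (level \<eta> q) else level \<eta> q)"
  using assms
proof (induction \<eta> i j rule: displace.induct)
  case (1 \<eta> i j)
  define n where "n = length \<eta>"
  define j' where "j' = first_site n j (\<lambda>k. \<eta> ! k < i)"
  define i' where "i' = \<eta> ! j'"
  show ?case
  proof (cases "i = 0")
    case True
    then show ?thesis using 1 by (simp add: displace.simps[of \<eta> 0 j])
  next
    case False
    then have vac: "\<exists>k<n. \<eta> ! k = 0" using 1 by (simp add: n_def)
    then have exP: "\<exists>k<n. \<eta> ! k < i" using False by force
    have j: "j < n" using 1 by (simp add: n_def)
    have j': "j' < n" and i': "i' < i"
      using first_site_ex[OF j exP] by (simp_all add: j'_def i'_def)
    have step: "displace \<eta> i j = displace (\<eta>[j' := i]) i' j'"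
      using i' by (subst displace.simps) (simp add: Let_def n_def[symmetric] j'_def[symmetric] i'_def[symmetric])
    \<comment> \<open>If the displaced entry is positive, the overwritten site was no vacancy, so
      the old vacancy survives.\<close>
    have vac': "\<exists>k<n. \<eta>[j' := i] ! k = 0" if "i' > 0"
    proof -
      obtain k where "k < n" "\<eta> ! k = 0" using vac by blast
      then show ?thesis using that by (intro exI[of _ k]) (cases "k = j'"; auto simp: i'_def)
    qed
    have IH: "length (displace (\<eta>[j' := i]) i' j') = n \<and> level (displace (\<eta>[j' := i]) i' j') q =
      (if q \<le> i' then insert (first_site n j' (\<lambda>k. \<eta>[j' := i] ! k < q)) (level (\<eta>[j' := i]) q)
       else level (\<eta>[j' := i]) q)"
      using "1.IH"[of j' i'] vac' i' j' 1 by (simp add: n_def[symmetric] j'_def i'_def)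
    have lev: "level (\<eta>[j' := i]) q = (if q \<le> i then insert j' (level \<eta> q) else level \<eta> q)"
      using j' i' by (auto simp: level_def nth_list_update n_def[symmetric] i'_def split: if_splits)
    have fs: "first_site n j' (\<lambda>k. \<eta> ! k < q) = first_site n j (\<lambda>k. \<eta> ! k < q)" if "q \<le> i"
      unfolding j'_def
    proof (rule first_site_first_site[OF j])
      show "\<exists>k<n. \<eta> ! k < q" using vac \<open>q \<ge> 1\<close> by force
    qed (use that in auto)
    \<comment> \<open>Either \<open>j'\<close> was already in the level and the cascade goes on, or
      the displaced entry is below \<open>q\<close> and the remaining moves leave the level
      alone.\<close>
    show ?thesis
    proof (cases "q \<le> i'")
      case True
      have "first_site n j' (\<lambda>k. \<eta>[j' := i] ! k < q) = first_site n j' (\<lambda>k. \<eta> ! k < q)"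
        by (rule first_site_cong)
          (use j j' i' True in \<open>auto simp: nth_list_update n_def[symmetric] i'_def\<close>)
      moreover have "j' \<in> level \<eta> q" using True j' by (simp add: level_def i'_def n_def)
      ultimately show ?thesis
        using IH lev True fs i' by (simp add: step n_def[symmetric] insert_absorb)
    next
      case False
      then have "first_site n j' (\<lambda>k. \<eta> ! k < q) = j'"
        using j' by (intro first_site_self) (simp_all add: i'_def)
      then show ?thesis using IH lev False fs by (simp add: step n_def[symmetric])
    qed
  qed
qed

lemma length_pushTASEP_bell:
  assumes "j < length \<eta>" "\<exists>k<length \<eta>. \<eta> ! k = 0"
  shows "length (pushTASEP_bell j \<eta>) = length \<eta>"
  using level_displace[OF assms(1), of "\<eta> ! j" 1] assms(2) by (simp add: pushTASEP_bell_def)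

lemma level_pushTASEP_bell:
  assumes "j < length \<eta>" "\<exists>k<length \<eta>. \<eta> ! k = 0" "q \<ge> 1"
  shows "level (pushTASEP_bell j \<eta>) q = push_set (length \<eta>) j (level \<eta> q)"
proof -
  define n where "n = length \<eta>"
  define \<zeta> where "\<zeta> = displace \<eta> (\<eta> ! j) j"
  have \<zeta>: "length \<zeta> = n" "level \<zeta> q =
    (if q \<le> \<eta> ! j then insert (first_site n j (\<lambda>k. \<eta> ! k < q)) (level \<eta> q) else level \<eta> q)"
    using level_displace[OF assms(1), of "\<eta> ! j" q] assms(2,3) by (simp_all add: \<zeta>_def n_def)
  have "level (pushTASEP_bell j \<eta>) q = level \<zeta> q - {j}"
    using assms(1,3) \<zeta>(1)
    by (auto simp: pushTASEP_bell_def level_def nth_list_update n_def \<zeta>_def[symmetric] split: if_splits)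
  also have "\<dots> = push_set n j (level \<eta> q)"
  proof (cases "q \<le> \<eta> ! j")
    case True
    have eq: "first_site n j (\<lambda>k. \<eta> ! k < q) = first_site n j (\<lambda>k. k \<notin> level \<eta> q)"
      by (rule first_site_cong) (use assms in \<open>auto simp: level_def n_def\<close>)
    \<comment> \<open>Site \<open>j\<close> keeps its old entry, at least \<open>q\<close>, during
      the search; hence vacating \<open>j\<close> at the end does not erase the site just
      gained.\<close>
    have ne: "first_site n j (\<lambda>k. \<eta> ! k < q) \<noteq> j"
    proof -
      have "\<exists>k<n. \<eta> ! k < q" using assms(2,3) by (force simp: n_def)
      from first_site_ex(2)[OF _ this, of j] show ?thesis using True assms(1) by (auto simp: n_def)
    qed
    have "j \<in> level \<eta> q" using True assms(1) by (simp add: level_def)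
    then show ?thesis using \<zeta> True eq ne by (auto simp: push_set_def)
  next
    case False
    then have "j \<notin> level \<eta> q" by (simp add: level_def)
    then show ?thesis using \<zeta> False by (simp add: push_set_def)
  qed
  finally show ?thesis by (simp add: n_def)
qed

section \<open>Labelling one row as a queue\<close>

text \<open>Labels arrive in decreasing order, so those at least \<open>q\<close> come first: during
  them every matched site joins the level, and afterwards the level is frozen. Labels above
  \<open>r\<close> tell matched sites from the default label \<open>r\<close>.\<close>

lemma level_match_particles:
  assumes "length L = n" "finite A"
    and "A \<subseteq> {..<n}" "length ps \<le> card A" "distinct ps"
    and "set ps \<subseteq> {..<n}" "\<And>j. j \<in> set ps \<Longrightarrow> r < L ! j"
    and "sorted (map (\<lambda>j. - int (L ! j)) ps)"
    and "fold (match_particle n L) ps (A, map (\<lambda>k. if k \<in> A then r else 0) [0..<n]) = (U, L')"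
  shows "U \<subseteq> A \<and> length L' = n \<and> card U + length ps = card A \<and> queue n A (set ps) (A - U) \<and>
    (\<forall>k\<in>U. L' ! k = r) \<and> (\<forall>k\<in>A. r \<le> L' ! k) \<and> (\<forall>k<n. k \<notin> A \<longrightarrow> L' ! k = 0) \<and>
    (\<forall>q>r. queue n A {j \<in> set ps. q \<le> L ! j} (level L' q))"
  using assms(4-)
proof (induction ps arbitrary: U L' rule: rev_induct)
  case Nil
  then have L': "U = A" "L' = map (\<lambda>k. if k \<in> A then r else 0) [0..<n]" by auto
  have "level L' q = {}" if "q > r" for q using that by (auto simp: level_def L')
  then show ?case using L' assms(3) by (auto simp: queue_empty)
next
  case (snoc j ps)
  obtain V K where VK: "fold (match_particle n L) ps (A, map (\<lambda>k. if k \<in> A then r else 0) [0..<n]) = (V, K)"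
    by fastforce
  have IH: "V \<subseteq> A" "length K = n" "card V + length ps = card A" "queue n A (set ps) (A - V)"
    "\<forall>k\<in>V. K ! k = r" "\<forall>k\<in>A. r \<le> K ! k" "\<forall>k<n. k \<notin> A \<longrightarrow> K ! k = 0"
    "\<And>q. q > r \<Longrightarrow> queue n A {j \<in> set ps. q \<le> L ! j} (level K q)"
    using snoc.IH[OF _ _ _ _ _ VK] snoc.prems by (auto simp: sorted_append)
  define k where "k = first_site n j (\<lambda>k. k \<in> V)"
  have UL: "U = V - {k}" "L' = K[k := L ! j]"
    using snoc.prems(6) unfolding fold_append comp_apply VK
    by (auto simp: match_particle_def k_def Let_def)
  have j: "j < n" "j \<notin> set ps" "r < L ! j" using snoc.prems by auto
  have finV: "finite V" using IH(1) assms(2) finite_subset by blast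
  \<comment> \<open>There are at most as many customers as services, so one is left for
    \<open>j\<close>.\<close>
  have "card V > 0" using IH(3) snoc.prems(1) by simp
  then have "V \<noteq> {}" by auto
  then have ex: "\<exists>k<n. k \<in> V" using IH(1) assms(3) by blast
  have k: "k < n" "k \<in> V" using first_site_ex[OF j(1) ex] by (auto simp: k_def)
  have AV: "A - (A - V) = V" using IH(1) by blast
  have dec: "L ! j \<le> L ! p" if "p \<in> set ps" for p
    using snoc.prems(5) that by (auto simp: sorted_append)
  have q1: "queue n A (insert j (set ps)) (insert k (A - V))"
    using queue_insert[OF IH(4) j(1,2)] ex AV by (simp add: k_def)
  have ins: "insert k (A - V) = A - U" using k IH(1) UL by blast
  have lev: "queue n A {p \<in> set (ps @ [j]). q \<le> L ! p} (level L' q)" if q: "q > r" for q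
  proof (cases "q \<le> L ! j")
    case True
    then have S: "{p \<in> set ps. q \<le> L ! p} = set ps" using dec by fastforce
    \<comment> \<open>All customers so far have labels at least \<open>q\<close>, so uniqueness of
      departures identifies the level with the set of matched sites.\<close>
    have "level K q = A - V" using queue_unique[OF IH(8)[OF q]] IH(4) S by simp
    moreover have "level L' q = insert k (level K q)"
      using True k IH(2) by (auto simp: UL level_def nth_list_update split: if_splits)
    moreover have "{p \<in> set (ps @ [j]). q \<le> L ! p} = insert j (set ps)" using True S by auto
    ultimately show ?thesis using q1 by simp
  next
    case False
    \<comment> \<open>Site \<open>k\<close> passes from label \<open>r\<close> to another label
      below \<open>q\<close>, so it stays outside the level.\<close>
    have "level L' q = level K q"
      using False k IH(2,5) q by (auto simp: UL level_def nth_list_update split: if_splits)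
    moreover have "{p \<in> set (ps @ [j]). q \<le> L ! p} = {p \<in> set ps. q \<le> L ! p}" using False by auto
    ultimately show ?thesis using IH(8)[OF q] by simp
  qed
  have "card U + length (ps @ [j]) = card A"
    using IH(3) k finV by (simp add: UL card_Diff_singleton) (metis Suc_pred \<open>card V > 0\<close> add_Suc)
  moreover have "\<forall>k'\<in>U. L' ! k' = r" using IH(5) k by (auto simp: UL nth_list_update)
  moreover have "\<forall>k'\<in>A. r \<le> L' ! k'" using IH(2,6) k(1) j(3) by (auto simp: UL nth_list_update)
  moreover have "L' ! k' = 0" if "k' < n" "k' \<notin> A" for k'
  proof -
    have "k \<noteq> k'" using IH(1) k(2) that by blast
    then show ?thesis using IH(7) that by (simp add: UL)
  qed
  ultimately show ?case
    using IH(1,2) q1 ins lev by (auto simp: UL)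
qed

text \<open>\<open>level L 1 = level L (Suc r)\<close> expresses that all particles of row
  \<open>Suc r\<close> have labels above \<open>r\<close>. Thresholds above \<open>r\<close> see the
  queue; positive ones up to \<open>r\<close> see every particle of the row, as unmatched ones keep
  label \<open>r\<close>.\<close>

lemma level_label_row:
  assumes "length L = n" "{k. (r, k) \<in> C} \<subseteq> {..<n}" "{k. (Suc r, k) \<in> C} = level L 1"
    and "level L 1 = level L (Suc r)" "card (level L 1) \<le> card {k. (r, k) \<in> C}"
  shows "length (label_row n C r L) = n"
    and "q > r \<Longrightarrow> queue n {k. (r, k) \<in> C} (level L q) (level (label_row n C r L) q)"
    and "1 \<le> q \<Longrightarrow> q \<le> r \<Longrightarrow> level (label_row n C r L) q = {k. (r, k) \<in> C}"
proof -
  define A where "A = {k. (r, k) \<in> C}"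
  define ps where "ps = matching_order n C r L"
  obtain U L' where UL: "fold (match_particle n L) ps (A, map (\<lambda>k. if k \<in> A then r else 0) [0..<n]) = (U, L')"
    by fastforce
  have L': "label_row n C r L = L'"
    using UL by (simp add: label_row_def ps_def A_def)
  have set: "set ps = level L 1"
    using assms(1,3) level_subset[of L 1] by (auto simp: ps_def matching_order_def)
  have dist: "distinct ps" by (simp add: ps_def matching_order_def)
  have "length ps = card (level L 1)" using distinct_card[OF dist] set by simp
  moreover have "sorted (map (\<lambda>j. - int (L ! j)) ps)"
    by (simp add: ps_def matching_order_def)
  moreover have "r < L ! j" if "j \<in> set ps" for j
    using that unfolding set assms(4) by (simp add: level_def)
  moreover have "set ps \<subseteq> {..<n}" using set level_subset[of L 1] assms(1) by simp
  moreover have A: "A \<subseteq> {..<n}" using assms(2) by (simp add: A_def)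
  moreover have "finite A" using A by (rule finite_subset) simp
  ultimately have *: "length L' = n" "\<forall>k\<in>A. r \<le> L' ! k" "\<forall>k<n. k \<notin> A \<longrightarrow> L' ! k = 0"
    "\<forall>q>r. queue n A {j \<in> set ps. q \<le> L ! j} (level L' q)"
    using level_match_particles[OF assms(1) _ _ _ dist _ _ _ UL] assms(5) by (simp_all add: A_def)
  show "length (label_row n C r L) = n" using * L' by simp
  show "queue n {k. (r, k) \<in> C} (level L q) (level (label_row n C r L) q)" if "q > r"
  proof -
    have "{j \<in> set ps. q \<le> L ! j} = level L q" using that by (auto simp: set level_def)
    with *(4)[rule_format, OF that] show ?thesis by (simp only: L' A_def)
  qed
  show "level (label_row n C r L) q = {k. (r, k) \<in> C}" if "1 \<le> q" "q \<le> r"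
    unfolding L' A_def[symmetric]
  proof (rule set_eqI)
    fix k
    show "k \<in> level L' q \<longleftrightarrow> k \<in> A"
    proof (cases "k \<in> A")
      case True
      then have "k < n" "r \<le> L' ! k" using A *(2) by auto
      then show ?thesis using True that *(1) by (simp add: level_def)
    next
      case False
      then show ?thesis using *(1,3) that by (auto simp: level_def)
    qed
  qed
qed

section \<open>The intertwining\<close>

definition row :: "multiline \<Rightarrow> nat \<Rightarrow> nat set" where
  "row C r = {k. (r, k) \<in> C}"

text \<open>At \<open>r = Suc s\<close> this is the empty row that starts the labelling, at
  \<open>r = 1\<close> the projection; general \<open>r\<close> allows induction from the top row
  down.\<close>

definition row_labels :: "nat \<Rightarrow> nat \<Rightarrow> multiline \<Rightarrow> nat \<Rightarrow> nat list" where
  "row_labels n s C r = foldr (label_row n C) [r..<Suc s] (replicate n 0)"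

lemma row_labels_Suc: "r \<le> s \<Longrightarrow> row_labels n s C r = label_row n C r (row_labels n s C (Suc r))"
  by (simp add: row_labels_def upt_conv_Cons del: upt_Suc)

lemma multiline_projection_eq: "multiline_projection n s C = row_labels n s C 1"
  by (simp add: multiline_projection_def row_labels_def)

text \<open>Labels only flow downwards, so changing row \<open>r\<close> leaves the labels of row
  \<open>Suc r\<close> alone.\<close>

lemma row_labels_cong:
  assumes "r \<le> Suc s" "\<And>r'. r' \<ge> r \<Longrightarrow> row C r' = row C' r'"
  shows "row_labels n s C r = row_labels n s C' r"
  using assms
proof (induction r rule: inc_induct)
  case base
  then show ?case by (simp add: row_labels_def)
next
  case (step r)
  have "(r', k) \<in> C \<longleftrightarrow> (r', k) \<in> C'" if "r' \<ge> r" for r' k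
    using step.prems[OF that] by (auto simp: row_def)
  then have "label_row n C r = label_row n C' r"
    by (simp add: fun_eq_iff label_row_def matching_order_def)
  then show ?case using step by (simp add: row_labels_Suc)
qed

section \<open>Particle counts of rows and levels\<close>

lemma tail_parts_Suc: "r \<le> s \<Longrightarrow> tail_parts s m r = m r + tail_parts s m (Suc r)"
  by (simp add: tail_parts_def sum.atLeast_Suc_atMost)

lemma tail_parts_antimono: "r \<le> r' \<Longrightarrow> tail_parts s m r' \<le> tail_parts s m r"
  unfolding tail_parts_def by (rule sum_mono2) auto

lemma tail_parts_0: "tail_parts s m 0 = num_parts s m"
  by (simp add: tail_parts_def num_parts_def atMost_atLeast0)

lemma tail_parts_greater: "s < r \<Longrightarrow> tail_parts s m r = 0"
  by (simp add: tail_parts_def)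

text \<open>Here \<open>m 0\<close> being positive enters: rows and levels keep a free site, so
  every jump has somewhere to land.\<close>

lemma tail_parts_less: "m 0 \<ge> 1 \<Longrightarrow> r \<ge> 1 \<Longrightarrow> tail_parts s m r < num_parts s m"
  using tail_parts_antimono[of 1 r s m] tail_parts_Suc[of 0 s m] by (simp add: tail_parts_0)

lemma row_subset: "C \<in> multiline_states s m \<Longrightarrow> row C r \<subseteq> {..<num_parts s m}"
  by (auto simp: multiline_states_def row_def)

lemma card_row:
  assumes "C \<in> multiline_states s m" "r \<ge> 1"
  shows "card (row C r) = tail_parts s m r"
proof (cases "r \<le> s")
  case True
  then show ?thesis using assms by (simp add: multiline_states_def row_def)
next
  case False
  then have "row C r = {}" using assms by (auto simp: multiline_states_def row_def)
  then show ?thesis using False by (simp add: tail_parts_greater)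
qed

lemma multiline_statesI:
  assumes "\<And>r. row C r \<subseteq> {..<num_parts s m}" "\<And>r. r \<notin> {1..s} \<Longrightarrow> row C r = {}"
    and "\<And>r. r \<in> {1..s} \<Longrightarrow> card (row C r) = tail_parts s m r"
  shows "C \<in> multiline_states s m"
  using assms by (fastforce simp: multiline_states_def row_def)

text \<open>Nonzero labels of row \<open>r\<close> are at least \<open>r\<close>, so positive
  thresholds up to \<open>r\<close> see the whole row, whence the \<open>max\<close>. For larger
  thresholds the queue hands down the count from the row above. The counts in turn show that row
  \<open>r\<close> can serve all of row \<open>Suc r\<close>, as \<open>level_label_row\<close>
  requires.\<close>

lemma row_labels_levels:
  assumes "C \<in> multiline_states s m" "1 \<le> r" "r \<le> Suc s"
  defines "n \<equiv> num_parts s m"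
  shows "length (row_labels n s C r) = n \<and>
    (\<forall>q\<ge>1. card (level (row_labels n s C r) q) = tail_parts s m (max q r)) \<and>
    (\<forall>q. 1 \<le> q \<and> q \<le> r \<longrightarrow> level (row_labels n s C r) q = row C r) \<and>
    (r \<le> s \<longrightarrow> (\<forall>q>r. queue n (row C r) (level (row_labels n s C (Suc r)) q) (level (row_labels n s C r) q)))"
  using assms(3,2)
proof (induction r rule: inc_induct)
  case base
  have "row C (Suc s) = {}" using assms(1) by (auto simp: multiline_states_def row_def)
  moreover have "level (replicate n 0) q = {}" if "q \<ge> 1" for q using that by (auto simp: level_def)
  ultimately show ?case by (auto simp: row_labels_def tail_parts_greater)
next
  case (step r)
  define L where "L = row_labels n s C (Suc r)"
  define A where "A = {k. (r, k) \<in> C}"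
  have rs: "r \<le> s" "1 \<le> r" using step by auto
  have IH: "length L = n" "\<And>q. q \<ge> 1 \<Longrightarrow> card (level L q) = tail_parts s m (max q (Suc r))"
    "\<And>q. 1 \<le> q \<Longrightarrow> q \<le> Suc r \<Longrightarrow> level L q = row C (Suc r)"
    using step.IH by (simp_all add: L_def)
  have A: "A = row C r" by (simp add: A_def row_def)
  have "card (level L 1) \<le> card A"
    using IH(2)[of 1] card_row[OF assms(1) rs(2)] tail_parts_antimono[of r "Suc r" s m] by (simp add: A)
  moreover have "A \<subseteq> {..<n}" using row_subset[OF assms(1)] by (simp add: A n_def)
  moreover have "{k. (Suc r, k) \<in> C} = level L 1" using IH(3)[of 1] by (simp add: row_def)
  moreover have "level L 1 = level L (Suc r)" using IH(3)[of 1] IH(3)[of "Suc r"] by simp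
  ultimately have *: "length (label_row n C r L) = n"
    "\<And>q. q > r \<Longrightarrow> queue n A (level L q) (level (label_row n C r L) q)"
    "\<And>q. 1 \<le> q \<Longrightarrow> q \<le> r \<Longrightarrow> level (label_row n C r L) q = A"
    using level_label_row[OF IH(1), of r C] unfolding A_def by blast+
  have "card (level (label_row n C r L) q) = tail_parts s m (max q r)" if "q \<ge> 1" for q
  proof (cases "q \<le> r")
    case True
    then show ?thesis using *(3)[of q] that card_row[OF assms(1) rs(2)] by (simp add: A max_def)
  next
    case False
    then have "card (level (label_row n C r L) q) = card (level L q)"
      using *(2)[of q] level_subset[of L q] IH(1) by (intro queue_card) auto
    moreover have "max q (Suc r) = q" "max q r = q" using False by simp_all
    ultimately show ?thesis using IH(2)[OF that] by simp
  qed
  then show ?case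
    using * unfolding row_labels_Suc[OF rs(1)] L_def[symmetric] A by blast
qed

lemma row_labels_vacancy:
  assumes "C \<in> multiline_states s m" "1 \<le> r" "r \<le> Suc s" "m 0 \<ge> 1"
  shows "\<exists>k<num_parts s m. row_labels (num_parts s m) s C r ! k = 0"
proof (rule ccontr)
  define L where "L = row_labels (num_parts s m) s C r"
  have L: "length L = num_parts s m" "card (level L 1) = tail_parts s m (max 1 r)"
    using row_labels_levels[OF assms(1-3)] by (auto simp: L_def)
  assume "\<not> ?thesis"
  then have "level L 1 = {..<num_parts s m}" using L by (auto simp: level_def L_def[symmetric] Suc_le_eq)
  then show False using L tail_parts_less[of m "max 1 r" s] assms by simp
qed

text \<open>Labels equal to \<open>v\<close> are counted by the difference of two successive level
  sizes, \<open>tail_parts s m v - tail_parts s m (Suc v)\<close>, which is \<open>m v\<close> for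
  \<open>v\<close> up to \<open>s\<close>.\<close>

lemma multiline_projection_state:
  assumes "C \<in> multiline_states s m"
  shows "multiline_projection (num_parts s m) s C \<in> pushTASEP_states s m"
proof -
  define n where "n = num_parts s m"
  define L where "L = multiline_projection n s C"
  have L: "length L = n" "\<And>q. q \<ge> 1 \<Longrightarrow> card (level L q) = tail_parts s m q"
    using row_labels_levels[OF assms, of 1] by (auto simp: L_def multiline_projection_eq n_def max_def)
  \<comment> \<open>Threshold 0 gives the whole ring, and \<open>tail_parts s m 0\<close> is
    \<open>n\<close>; this extends the count to the vacancies.\<close>
  have card: "card (level L q) = tail_parts s m q" for q
    using L by (cases "q = 0") (simp_all add: level_def tail_parts_0 n_def)
  have "count (mset L) v = count (content s m) v" for v
  proof -
    have "count (mset L) v = card {k. k < length L \<and> L ! k = v}"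
      by (simp add: count_mset count_list_eq_length_filter length_filter_conv_card eq_commute[of v])
    also have "{k. k < length L \<and> L ! k = v} = level L v - level L (Suc v)"
      by (auto simp: level_def)
    also have "card \<dots> = card (level L v) - card (level L (Suc v))"
      by (rule card_Diff_subset) (auto simp: level_def)
    also have "\<dots> = (if v \<le> s then m v else 0)"
      using tail_parts_Suc[of v s m] by (simp add: card tail_parts_greater)
    also have "\<dots> = count (content s m) v"
      by (simp add: content_def count_sum)
    finally show ?thesis .
  qed
  then show ?thesis
    by (simp add: pushTASEP_states_def permutations_of_multiset_def multiset_eq_iff L_def n_def)
qed

section \<open>Effect of a bell on the labels of each row\<close>

lemma row_bell_eq:
  obtains C' where "row_bell n r (C, i) = (C', push_target n i (row C r))"
    "row C' r = push_set n i (row C r)" "\<And>r'. r' \<noteq> r \<Longrightarrow> row C' r' = row C r'"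
proof -
  have "row (fst (row_bell n r (C, i))) r = push_set n i (row C r)"
    by (auto simp: row_bell_def row_def push_set_def Let_def)
  moreover have "row (fst (row_bell n r (C, i))) r' = row C r'" if "r' \<noteq> r" for r'
    using that by (auto simp: row_bell_def row_def Let_def)
  moreover have "snd (row_bell n r (C, i)) = push_target n i (row C r)"
    by (auto simp: row_bell_def row_def push_target_def Let_def)
  ultimately show thesis using that by (metis prod.collapse)
qed

lemma card_push_set:
  assumes "i < n" "\<exists>k<n. k \<notin> B" "B \<subseteq> {..<n}"
  shows "card (push_set n i B) = card B" "push_set n i B \<subseteq> {..<n}"
proof -
  have fin: "finite B" using assms(3) finite_subset by blast
  note fs = first_site_ex[OF assms(1,2)]
  show "card (push_set n i B) = card B"
  proof (cases "i \<in> B")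
    case True
    then have "card (push_set n i B) = Suc (card (B - {i}))"
      using fs(2) fin by (simp add: push_set_def)
    then show ?thesis using card_Suc_Diff1[OF fin True] by simp
  qed (simp add: push_set_def)
  show "push_set n i B \<subseteq> {..<n}" using fs(1) assms(3) by (auto simp: push_set_def)
qed

lemma ex_not_row:
  assumes "C \<in> multiline_states s m" "m 0 \<ge> 1" "r \<ge> 1"
  shows "\<exists>k<num_parts s m. k \<notin> row C r"
proof (rule ccontr)
  assume "\<not> ?thesis"
  then have "row C r = {..<num_parts s m}" using row_subset[OF assms(1)] by blast
  then show False using card_row[OF assms(1,3)] tail_parts_less[of m r s] assms by simp
qed

text \<open>Induction from the top row down, for all \<open>C\<close> and \<open>i\<close>, because
  the bell passed upwards may ring at another column and in a changed diagram. In each row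
  \<open>queue_push\<close> predicts the levels after the bell, and \<open>queue_unique\<close>
  shows that relabelling yields exactly these.\<close>

lemma row_labels_bell:
  assumes "m 0 \<ge> 1" "C \<in> multiline_states s m" "1 \<le> r" "r \<le> Suc s" "i < num_parts s m"
  defines "n \<equiv> num_parts s m"
  shows "\<exists>C' i'. fold (row_bell n) [r..<Suc s] (C, i) = (C', i') \<and> C' \<in> multiline_states s m \<and>
    (\<forall>r'<r. row C' r' = row C r') \<and> row_labels n s C' r = pushTASEP_bell i (row_labels n s C r)"
  using assms(4,2,3,5)
proof (induction r arbitrary: C i rule: inc_induct)
  case base
  \<comment> \<open>Above row \<open>s\<close> no bell rings, and a bell at a vacancy changes
    nothing.\<close>
  have "pushTASEP_bell i (replicate n 0) = replicate n 0"
    using base by (simp add: pushTASEP_bell_def displace.simps[of _ 0] n_def list_update_same_conv)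
  then show ?case using base by (simp add: row_labels_def)
next
  case (step r)
  have rs: "r \<le> s" "1 \<le> r" and i: "i < n" using step by (auto simp: n_def)
  note C = step.prems(1)
  note exA = ex_not_row[OF C assms(1), folded n_def]
  obtain C1 where C1: "row_bell n r (C, i) = (C1, push_target n i (row C r))"
    "row C1 r = push_set n i (row C r)" "\<And>r'. r' \<noteq> r \<Longrightarrow> row C1 r' = row C r'"
    by (rule row_bell_eq[of n r C i]) (rule that)
  define i1 where "i1 = push_target n i (row C r)"
  have i1: "i1 < n"
    using first_site_ex[OF i exA[OF rs(2)]] i by (simp add: i1_def push_target_def)
  have C1s: "C1 \<in> multiline_states s m"
  proof (rule multiline_statesI)
    fix r'
    have sub: "row C r' \<subseteq> {..<n}" for r' using row_subset[OF C] by (simp add: n_def)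
    note push = card_push_set[OF i exA[OF rs(2)] sub]
    show "row C1 r' \<subseteq> {..<num_parts s m}"
      using push(2) C1(2,3) sub by (cases "r' = r") (simp_all add: n_def)
    show "row C1 r' = {}" if "r' \<notin> {1..s}"
      using that rs C1(3)[of r'] C by (cases "r' = r") (auto simp: multiline_states_def row_def)
    show "card (row C1 r') = tail_parts s m r'" if "r' \<in> {1..s}"
      using that push(1) C1(2,3) card_row[OF C, of r'] by (cases "r' = r") simp_all
  qed
  obtain C' i' where C': "fold (row_bell n) [Suc r..<Suc s] (C1, i1) = (C', i')"
    "C' \<in> multiline_states s m" "\<And>r'. r' < Suc r \<Longrightarrow> row C' r' = row C1 r'"
    "row_labels n s C' (Suc r) = pushTASEP_bell i1 (row_labels n s C1 (Suc r))"
    using step.IH[OF C1s _ i1[unfolded n_def]] by auto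
  define L where "L = row_labels n s C (Suc r)"
  define K where "K = row_labels n s C r"
  define K' where "K' = row_labels n s C' r"
  \<comment> \<open>The bell on row \<open>r\<close> leaves the particles above in place, so the
    induction hypothesis for \<open>C1\<close> speaks of the old labels \<open>L\<close>.\<close>
  have L1: "row_labels n s C1 (Suc r) = L"
    unfolding L_def using C1(3) rs by (intro row_labels_cong) auto
  have rowr: "row C' r = push_set n i (row C r)" using C'(3) C1(2) by simp
  have L: "length L = n" "\<And>q. q \<ge> 1 \<Longrightarrow> card (level L q) = tail_parts s m (max q (Suc r))"
    using row_labels_levels[OF C, of "Suc r"] rs by (auto simp: L_def n_def)
  have K: "length K = n" "\<And>q. 1 \<le> q \<Longrightarrow> q \<le> r \<Longrightarrow> level K q = row C r"
    "\<And>q. q > r \<Longrightarrow> queue n (row C r) (level L q) (level K q)"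
    using row_labels_levels[OF C, of r] rs by (auto simp: K_def L_def n_def)
  have K': "length K' = n" "\<And>q. 1 \<le> q \<Longrightarrow> q \<le> r \<Longrightarrow> level K' q = row C' r"
    "\<And>q. q > r \<Longrightarrow> queue n (row C' r) (level (pushTASEP_bell i1 L) q) (level K' q)"
    using row_labels_levels[OF C'(2), of r] rs C'(4) L1 by (auto simp: K'_def n_def)
  have vL: "\<exists>k<length L. L ! k = 0"
    using row_labels_vacancy[OF C _ _ assms(1), of "Suc r"] rs L by (simp add: L_def n_def)
  have vK: "\<exists>k<length K. K ! k = 0"
    using row_labels_vacancy[OF C _ _ assms(1), of r] rs K by (simp add: K_def n_def)
  have lev: "level K' q = push_set n i (level K q)" if q: "q \<ge> 1" for q
  proof (cases "q \<le> r")
    case True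
    then show ?thesis using K(2) K'(2) rowr q by simp
  next
    case False
    have "\<exists>k<n. k \<notin> level L q"
      using vL q L by (force simp: level_def)
    \<comment> \<open>Two departure sets for the same services and arrivals: the old level pushed at
      \<open>i\<close>, and the level computed afresh from the new diagram.\<close>
    then have "queue n (push_set n i (row C r)) (push_set n i1 (level L q)) (push_set n i (level K q))"
      unfolding i1_def using K(3)[of q] False i exA[OF rs(2)] by (intro queue_push) auto
    moreover have "push_set n i1 (level L q) = level (pushTASEP_bell i1 L) q"
      using level_pushTASEP_bell[of i1 L q] vL q i1 L by simp
    moreover have "queue n (push_set n i (row C r)) (level (pushTASEP_bell i1 L) q) (level K' q)"
      using K'(3)[of q] False rowr by simp
    ultimately show ?thesis by (metis queue_unique)
  qed
  have "K' = pushTASEP_bell i K"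
  proof (rule list_eq_level)
    show "length K' = length (pushTASEP_bell i K)"
      using length_pushTASEP_bell[of i K] vK K K' i by simp
    show "level K' q = level (pushTASEP_bell i K) q" if "q \<ge> 1" for q
      using lev[OF that] level_pushTASEP_bell[of i K q] vK K i that by simp
  qed
  moreover have "fold (row_bell n) [r..<Suc s] (C, i) = (C', i')"
  proof -
    have "[r..<Suc s] = r # [Suc r..<Suc s]" using rs by (simp add: upt_conv_Cons del: upt_Suc)
    then show ?thesis using C'(1) by (simp only: fold_simps C1(1) i1_def)
  qed
  moreover have "\<forall>r'<r. row C' r' = row C r'" using C'(3) C1(3) by simp
  ultimately show ?case using C'(2) by (simp add: K_def K'_def)
qed

lemma multiline_projection_bell:
  assumes "m 0 \<ge> 1" "C \<in> multiline_states s m" "i < num_parts s m"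
  shows "multiline_bell (num_parts s m) s i C \<in> multiline_states s m"
    and "multiline_projection (num_parts s m) s (multiline_bell (num_parts s m) s i C) =
      pushTASEP_bell i (multiline_projection (num_parts s m) s C)"
  using row_labels_bell[OF assms(1,2) _ _ assms(3), of 1]
  by (auto simp: multiline_bell_def multiline_projection_eq simp del: upt_Suc)

lemma finite_multiline_states: "finite (multiline_states s m)"
proof (rule finite_subset)
  show "multiline_states s m \<subseteq> Pow ({1..s} \<times> {..<num_parts s m})"
    by (auto simp: multiline_states_def)
qed simp

section \<open>Lumping of Markov chains\<close>

text \<open>A crude bound, one factor of the sum of all absolute entries per power; it lets an
  exponential series dominate that of \<open>transition_prob\<close>.\<close>

lemma abs_generator_power_le:
  assumes "finite S" "a \<in> S" "b \<in> S"
  shows "\<bar>generator_power S Q k a b\<bar> \<le> (\<Sum>a\<in>S. \<Sum>b\<in>S. \<bar>Q a b\<bar>) ^ k"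
  using assms(2)
proof (induction k arbitrary: a)
  case (Suc k)
  define K where "K = (\<Sum>a\<in>S. \<Sum>b\<in>S. \<bar>Q a b\<bar>)"
  have "K \<ge> 0" unfolding K_def by (intro sum_nonneg) auto
  have "\<bar>generator_power S Q (Suc k) a b\<bar> \<le> (\<Sum>c\<in>S. \<bar>Q a c\<bar> * \<bar>generator_power S Q k c b\<bar>)"
    using sum_abs[of "\<lambda>c. Q a c * generator_power S Q k c b" S] by (simp add: abs_mult)
  also have "\<dots> \<le> (\<Sum>c\<in>S. \<bar>Q a c\<bar> * K ^ k)"
    using Suc.IH unfolding K_def by (intro sum_mono mult_left_mono) auto
  also have "\<dots> = (\<Sum>c\<in>S. \<bar>Q a c\<bar>) * K ^ k" by (simp add: sum_distrib_right)
  also have "\<dots> \<le> K * K ^ k"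
    using \<open>K \<ge> 0\<close> assms(1) Suc.prems unfolding K_def
    by (intro mult_right_mono member_le_sum[of a S "\<lambda>a. \<Sum>b\<in>S. \<bar>Q a b\<bar>"]) (auto intro: sum_nonneg)
  finally show ?case by (simp add: K_def)
qed simp

lemma summable_transition_prob:
  assumes "finite S" "a \<in> S" "b \<in> S"
  shows "summable (\<lambda>k. t ^ k / fact k * generator_power S Q k a b)"
proof (rule summable_comparison_test)
  define K where "K = (\<Sum>a\<in>S. \<Sum>b\<in>S. \<bar>Q a b\<bar>)"
  show "\<exists>N. \<forall>k\<ge>N. norm (t ^ k / fact k * generator_power S Q k a b) \<le> (\<bar>t\<bar> * K) ^ k /\<^sub>R fact k"
  proof (intro exI allI impI)
    fix k :: nat
    have "\<bar>t\<bar> ^ k / fact k * \<bar>generator_power S Q k a b\<bar> \<le> \<bar>t\<bar> ^ k / fact k * K ^ k"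
      unfolding K_def by (intro mult_left_mono abs_generator_power_le assms) auto
    then show "norm (t ^ k / fact k * generator_power S Q k a b) \<le> (\<bar>t\<bar> * K) ^ k /\<^sub>R fact k"
      by (simp add: abs_mult power_abs power_mult_distrib divide_inverse mult_ac)
  qed
  show "summable (\<lambda>k. (\<bar>t\<bar> * K) ^ k /\<^sub>R fact k)"
    by (rule summable_exp_generic)
qed

text \<open>The condition \<open>lump\<close> is strong lumpability, under which the image chain is
  Markov for every initial law.\<close>

locale lumping =
  fixes S :: "'a set" and T :: "'b set" and Q :: "'a \<Rightarrow> 'a \<Rightarrow> real" and R :: "'b \<Rightarrow> 'b \<Rightarrow> real"
    and p :: "'a \<Rightarrow> 'b"
  assumes finite_S: "finite S" and finite_T: "finite T" and p_in: "a \<in> S \<Longrightarrow> p a \<in> T"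
    and lump: "a \<in> S \<Longrightarrow> b \<in> T \<Longrightarrow> (\<Sum>c | c \<in> S \<and> p c = b. Q a c) = R (p a) b"
begin

text \<open>With P the 0-1 matrix of \<open>p\<close>, the condition \<open>lump\<close> reads Q P =
  P R, hence Q^k P = P R^k.\<close>

lemma generator_power_lump:
  assumes "a \<in> S" "b \<in> T"
  shows "(\<Sum>c | c \<in> S \<and> p c = b. generator_power S Q k a c) = generator_power T R k (p a) b"
  using assms(1)
proof (induction k arbitrary: a)
  case 0
  then show ?case
    using finite_S by (simp add: of_bool_def sum.delta)
next
  case (Suc k)
  have "(\<Sum>c | c \<in> S \<and> p c = b. generator_power S Q (Suc k) a c) =
      (\<Sum>d\<in>S. Q a d * (\<Sum>c | c \<in> S \<and> p c = b. generator_power S Q k d c))"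
    by (simp add: sum_distrib_left) (rule sum.swap)
  also have "\<dots> = (\<Sum>d\<in>S. Q a d * generator_power T R k (p d) b)"
    using Suc.IH by simp
  also have "\<dots> = (\<Sum>e\<in>T. \<Sum>d | d \<in> S \<and> p d = e. Q a d * generator_power T R k (p d) b)"
    using finite_S finite_T p_in by (intro sum.group[symmetric]) auto
  also have "\<dots> = (\<Sum>e\<in>T. (\<Sum>d | d \<in> S \<and> p d = e. Q a d) * generator_power T R k e b)"
    by (simp add: sum_distrib_right)
  also have "\<dots> = generator_power T R (Suc k) (p a) b"
    using lump[OF Suc.prems] by simp
  finally show ?case .
qed

lemma transition_prob_lump:
  assumes "a \<in> S" "b \<in> T"
  shows "(\<Sum>c | c \<in> S \<and> p c = b. transition_prob S Q t a c) = transition_prob T R t (p a) b"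
proof -
  have "(\<Sum>c | c \<in> S \<and> p c = b. transition_prob S Q t a c) =
      (\<Sum>k. \<Sum>c | c \<in> S \<and> p c = b. t ^ k / fact k * generator_power S Q k a c)"
    unfolding transition_prob_def
    using finite_S assms by (intro suminf_sum[symmetric] summable_transition_prob) auto
  also have "\<dots> = (\<Sum>k. t ^ k / fact k * generator_power T R k (p a) b)"
    by (simp only: sum_distrib_left[symmetric] generator_power_lump[OF assms])
  finally show ?thesis by (simp add: transition_prob_def)
qed

text \<open>Summing over the last state of a lifted path gives a factor depending only on the image
  of the state before it. Peeling off steps from the end leaves the initial weights
  \<open>f\<close>.\<close>

lemma sum_paths_lump:
  assumes "\<And>i. i \<le> k \<Longrightarrow> b i \<in> T"
  shows "(\<Sum>c \<in> (\<Pi>\<^sub>E i\<in>{..k}. {a \<in> S. p a = b i}).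
      f (c 0) * (\<Prod>i<k. transition_prob S Q (d i) (c i) (c (Suc i)))) =
    (\<Sum>a | a \<in> S \<and> p a = b 0. f a) * (\<Prod>i<k. transition_prob T R (d i) (b i) (b (Suc i)))"
  using assms
proof (induction k)
  case 0
  have "(\<Sum>c \<in> (\<Pi>\<^sub>E i\<in>{..0}. {a \<in> S. p a = b i}). f (c 0)) = (\<Sum>a | a \<in> S \<and> p a = b 0. f a)"
    by (rule sum.reindex_bij_witness[of _ "\<lambda>a. \<lambda>i\<in>{0}. a" "\<lambda>c. c 0"])
      (auto simp: PiE_iff extensional_def fun_eq_iff)
  then show ?case by simp
next
  case (Suc k)
  let ?F = "\<lambda>i. {a \<in> S. p a = b i}"
  let ?g = "\<lambda>c. f (c 0) * (\<Prod>i<k. transition_prob S Q (d i) (c i) (c (Suc i)))"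
  have "(\<Sum>c \<in> Pi\<^sub>E {..Suc k} ?F. f (c 0) * (\<Prod>i<Suc k. transition_prob S Q (d i) (c i) (c (Suc i)))) =
      (\<Sum>(a, c) \<in> ?F (Suc k) \<times> Pi\<^sub>E {..k} ?F. ?g c * transition_prob S Q (d k) (c k) a)"
  \<comment> \<open>The bijection cuts off the last state; \<open>restrict\<close> keeps the
    shortened path extensional.\<close>
  proof (rule sum.reindex_bij_witness[of _ "\<lambda>(a, c). c(Suc k := a)" "\<lambda>c. (c (Suc k), restrict c {..k})"])
    fix c assume c: "c \<in> Pi\<^sub>E {..Suc k} ?F"
    show "(case (c (Suc k), restrict c {..k}) of (a, c) \<Rightarrow> c(Suc k := a)) = c"
      using c by (auto simp: fun_eq_iff PiE_iff extensional_def)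
    show "(c (Suc k), restrict c {..k}) \<in> ?F (Suc k) \<times> Pi\<^sub>E {..k} ?F"
      using c by (auto simp: PiE_iff)
    show "(case (c (Suc k), restrict c {..k}) of (a, c) \<Rightarrow> ?g c * transition_prob S Q (d k) (c k) a) =
        f (c 0) * (\<Prod>i<Suc k. transition_prob S Q (d i) (c i) (c (Suc i)))"
      by (simp add: mult.assoc)
  next
    fix ac assume "ac \<in> ?F (Suc k) \<times> Pi\<^sub>E {..k} ?F"
    then show "(case ac of (a, c) \<Rightarrow> c(Suc k := a)) \<in> Pi\<^sub>E {..Suc k} ?F"
      "((case ac of (a, c) \<Rightarrow> c(Suc k := a)) (Suc k), restrict (case ac of (a, c) \<Rightarrow> c(Suc k := a)) {..k}) = ac"
      by (auto simp: PiE_iff extensional_def fun_eq_iff le_Suc_eq split: prod.splits)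
  qed
  also have "\<dots> = (\<Sum>a\<in>?F (Suc k). \<Sum>c\<in>Pi\<^sub>E {..k} ?F. ?g c * transition_prob S Q (d k) (c k) a)"
    by (simp add: sum.cartesian_product)
  also have "\<dots> = (\<Sum>c\<in>Pi\<^sub>E {..k} ?F. ?g c * (\<Sum>a\<in>?F (Suc k). transition_prob S Q (d k) (c k) a))"
    by (subst sum.swap) (simp add: sum_distrib_left)
  also have "\<dots> = (\<Sum>c\<in>Pi\<^sub>E {..k} ?F. ?g c * transition_prob T R (d k) (b k) (b (Suc k)))"
  proof (intro sum.cong refl)
    fix c assume "c \<in> Pi\<^sub>E {..k} ?F"
    then have "c k \<in> S" "p (c k) = b k" by (auto simp: PiE_iff)
    then show "?g c * (\<Sum>a\<in>?F (Suc k). transition_prob S Q (d k) (c k) a) =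
        ?g c * transition_prob T R (d k) (b k) (b (Suc k))"
      using transition_prob_lump[of "c k" "b (Suc k)" "d k"] Suc.prems by simp
  qed
  also have "\<dots> = (\<Sum>c\<in>Pi\<^sub>E {..k} ?F. ?g c) * transition_prob T R (d k) (b k) (b (Suc k))"
    by (simp add: sum_distrib_right)
  also have "\<dots> = (\<Sum>a\<in>?F 0. f a) * (\<Prod>i<Suc k. transition_prob T R (d i) (b i) (b (Suc i)))"
    using Suc by (simp add: mult.assoc)
  finally show ?case .
qed

text \<open>A projected path is observed exactly when one of its finitely many lifts is, and
  distinct lifts are disjoint events; \<open>sum_paths_lump\<close> evaluates the resulting
  sum.\<close>

theorem markov_chain_lump:
  assumes "markov_chain M S Q X"
  shows "markov_chain M T R (\<lambda>t \<omega>. p (X t \<omega>))"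
proof -
  interpret prob_space M using assms by (simp add: markov_chain_def)
  have X: "X t \<in> M \<rightarrow>\<^sub>M count_space S" if "t \<ge> 0" for t
    using assms that by (simp add: markov_chain_def)
  have "p \<in> count_space S \<rightarrow>\<^sub>M count_space T" using p_in by simp
  then have meas: "(\<lambda>\<omega>. p (X t \<omega>)) \<in> M \<rightarrow>\<^sub>M count_space T" if "t \<ge> 0" for t
    using measurable_compose[OF X[OF that]] by blast
  \<comment> \<open>Right-continuity for the discrete topology means being constant just after
    \<open>t\<close>, which any map preserves.\<close>
  have rc: "AE \<omega> in M. \<forall>t\<ge>0. \<forall>\<^sub>F u in at_right t. p (X u \<omega>) = p (X t \<omega>)"
  proof -
    have "AE \<omega> in M. \<forall>t\<ge>0. \<forall>\<^sub>F u in at_right t. X u \<omega> = X t \<omega>"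
      using assms by (simp add: markov_chain_def)
    then show ?thesis
    proof eventually_elim
      case (elim \<omega>)
      show ?case
      proof (intro allI impI)
        fix t :: real assume "0 \<le> t"
        then have "\<forall>\<^sub>F u in at_right t. X u \<omega> = X t \<omega>" using elim by blast
        then show "\<forall>\<^sub>F u in at_right t. p (X u \<omega>) = p (X t \<omega>)" by (rule eventually_mono) simp
      qed
    qed
  qed
  have fdd: "\<P>(\<omega> in M. \<forall>i\<le>k. p (X (t i) \<omega>) = b i) = \<P>(\<omega> in M. p (X (t 0) \<omega>) = b 0) *
      (\<Prod>i<k. transition_prob T R (t (Suc i) - t i) (b i) (b (Suc i)))"
    if t: "0 \<le> t 0" "\<forall>i<k. t i \<le> t (Suc i)" and b: "\<forall>i\<le>k. b i \<in> T" for k t b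
  proof -
    let ?F = "\<lambda>i. {a \<in> S. p a = b i}"
    have t0: "t i \<ge> 0" if "i \<le> k" for i
      using that
    proof (induction i)
      case (Suc i)
      then have "t i \<le> t (Suc i)" using t(2) by simp
      then show ?case using Suc by simp
    qed (use t in simp)
    have XS: "X (t i) \<omega> \<in> S" if "i \<le> k" "\<omega> \<in> space M" for i \<omega>
      using measurable_space[OF X[OF t0[OF that(1)]] that(2)] by simp
    have ev: "{\<omega> \<in> space M. X (t i) \<omega> = a} \<in> sets M" if "i \<le> k" for i a
    proof -
      have "{\<omega> \<in> space M. X (t i) \<omega> = a} = X (t i) -` ({a} \<inter> S) \<inter> space M"
        using XS[OF that] by blast
      also have "\<dots> \<in> sets M" by (rule measurable_sets[OF X[OF t0[OF that]]]) simp
      finally show ?thesis .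
    qed
    have evs: "{\<omega> \<in> space M. \<forall>i\<le>j. X (t i) \<omega> = c i} \<in> sets M" if "j \<le> k" for j c
    proof -
      have "{\<omega> \<in> space M. \<forall>i\<in>{..j}. X (t i) \<omega> = c i} \<in> sets M"
        using that by (intro sets.sets_Collect_finite_All ev) auto
      then show ?thesis by (simp only: Ball_def atMost_iff)
    qed
    \<comment> \<open>Stated for all \<open>j\<close> up to \<open>k\<close> because it serves
      twice: \<open>j = k\<close> for the path and \<open>j = 0\<close> for the initial law.\<close>
    have paths: "\<P>(\<omega> in M. \<forall>i\<le>j. p (X (t i) \<omega>) = b i) =
        (\<Sum>c\<in>Pi\<^sub>E {..j} ?F. \<P>(\<omega> in M. \<forall>i\<le>j. X (t i) \<omega> = c i))" if jk: "j \<le> k" for j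
    proof -
      have U: "{\<omega> \<in> space M. \<forall>i\<le>j. p (X (t i) \<omega>) = b i} =
          (\<Union>c\<in>Pi\<^sub>E {..j} ?F. {\<omega> \<in> space M. \<forall>i\<le>j. X (t i) \<omega> = c i})"
      proof (intro equalityI subsetI)
        fix \<omega> assume \<omega>: "\<omega> \<in> {\<omega> \<in> space M. \<forall>i\<le>j. p (X (t i) \<omega>) = b i}"
        have "X (t i) \<omega> \<in> ?F i" if "i \<le> j" for i
          using \<omega> XS[of i \<omega>] that jk by simp
        \<comment> \<open>Restricting to \<open>{..j}\<close> makes the observed path extensional,
          as membership in \<open>PiE\<close> demands.\<close>
        then have "(\<lambda>i\<in>{..j}. X (t i) \<omega>) \<in> Pi\<^sub>E {..j} ?F" by simp
        then show "\<omega> \<in> (\<Union>c\<in>Pi\<^sub>E {..j} ?F. {\<omega> \<in> space M. \<forall>i\<le>j. X (t i) \<omega> = c i})"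
          by (rule UN_I) (use \<omega> in simp)
      next
        fix \<omega> assume "\<omega> \<in> (\<Union>c\<in>Pi\<^sub>E {..j} ?F. {\<omega> \<in> space M. \<forall>i\<le>j. X (t i) \<omega> = c i})"
        then obtain c where c: "c \<in> Pi\<^sub>E {..j} ?F" "\<omega> \<in> space M" "\<forall>i\<le>j. X (t i) \<omega> = c i" by blast
        have "p (X (t i) \<omega>) = b i" if "i \<le> j" for i
          using PiE_mem[OF c(1), of i] c(3) that by simp
        then show "\<omega> \<in> {\<omega> \<in> space M. \<forall>i\<le>j. p (X (t i) \<omega>) = b i}" using c(2) by simp
      qed
      have disj: "disjoint_family_on (\<lambda>c. {\<omega> \<in> space M. \<forall>i\<le>j. X (t i) \<omega> = c i}) (Pi\<^sub>E {..j} ?F)"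
        unfolding disjoint_family_on_def
      proof (intro ballI impI)
        fix c c' assume c: "c \<in> Pi\<^sub>E {..j} ?F" "c' \<in> Pi\<^sub>E {..j} ?F" "c \<noteq> c'"
        obtain i where "i \<in> {..j}" "c i \<noteq> c' i"
          using PiE_ext[OF c(1,2)] c(3) by blast
        then show "{\<omega> \<in> space M. \<forall>i\<le>j. X (t i) \<omega> = c i} \<inter> {\<omega> \<in> space M. \<forall>i\<le>j. X (t i) \<omega> = c' i} = {}"
          by auto
      qed
      have fin: "finite (Pi\<^sub>E {..j} ?F)" using finite_S by (intro finite_PiE) auto
      have im: "(\<lambda>c. {\<omega> \<in> space M. \<forall>i\<le>j. X (t i) \<omega> = c i}) ` Pi\<^sub>E {..j} ?F \<subseteq> events"
        using evs[OF jk] by blast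
      show ?thesis
        unfolding U by (rule finite_measure_finite_Union[OF fin im disj])
    qed
    have "\<P>(\<omega> in M. \<forall>i\<le>k. p (X (t i) \<omega>) = b i) =
        (\<Sum>c\<in>Pi\<^sub>E {..k} ?F. \<P>(\<omega> in M. X (t 0) \<omega> = c 0) *
          (\<Prod>i<k. transition_prob S Q (t (Suc i) - t i) (c i) (c (Suc i))))"
      unfolding paths[OF order_refl]
      using assms t by (intro sum.cong) (auto simp: markov_chain_def PiE_iff)
    also have "\<dots> = (\<Sum>a | a \<in> S \<and> p a = b 0. \<P>(\<omega> in M. X (t 0) \<omega> = a)) *
        (\<Prod>i<k. transition_prob T R (t (Suc i) - t i) (b i) (b (Suc i)))"
      using b by (intro sum_paths_lump) auto
    also have "(\<Sum>a | a \<in> S \<and> p a = b 0. \<P>(\<omega> in M. X (t 0) \<omega> = a)) = \<P>(\<omega> in M. p (X (t 0) \<omega>) = b 0)"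
    proof -
      have "(\<Sum>a | a \<in> S \<and> p a = b 0. \<P>(\<omega> in M. X (t 0) \<omega> = a)) =
          (\<Sum>c\<in>Pi\<^sub>E {..0} ?F. \<P>(\<omega> in M. X (t 0) \<omega> = c 0))"
        using sum_paths_lump[of 0 b "\<lambda>a. \<P>(\<omega> in M. X (t 0) \<omega> = a)"] b by simp
      then show ?thesis using paths[of 0] by simp
    qed
    finally show ?thesis .
  qed
  show ?thesis
    unfolding markov_chain_def using meas rc fdd prob_space_axioms by blast
qed

text \<open>The law of the projected process at any time is the image under \<open>p\<close> of the
  original law at that time.\<close>

lemma in_stationarity_lump:
  assumes "markov_chain M S Q X" "in_stationarity M S X"
  shows "in_stationarity M T (\<lambda>t \<omega>. p (X t \<omega>))"
proof -
  have p: "p \<in> count_space S \<rightarrow>\<^sub>M count_space T" using p_in by simp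
  have *: "distr M (count_space T) (\<lambda>\<omega>. p (X t \<omega>)) = distr (distr M (count_space S) (X t)) (count_space T) p"
    if "t \<ge> 0" for t
    using assms(1) that by (subst distr_distr[OF p]) (auto simp: markov_chain_def comp_def)
  show ?thesis
    unfolding in_stationarity_def
  proof (intro allI impI)
    fix t :: real assume t: "0 \<le> t"
    then have X: "distr M (count_space S) (X t) = distr M (count_space S) (X 0)"
      using assms(2) unfolding in_stationarity_def by blast
    show "distr M (count_space T) (\<lambda>\<omega>. p (X t \<omega>)) = distr M (count_space T) (\<lambda>\<omega>. p (X 0 \<omega>))"
      unfolding *[OF t] *[OF order_refl] X ..
  qed
qed

end

section \<open>Bell dynamics as a lumping\<close>

text \<open>A bell moves \<open>a\<close> to the single state \<open>f i a\<close>, so summing its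
  indicator over a fibre tests whether \<open>p (f i a)\<close>, that is \<open>g i (p a)\<close>,
  is the base point. Bells correspond one to one at equal rates.\<close>

lemma lumping_bell_generator:
  assumes "finite S" "finite T" "\<And>a. a \<in> S \<Longrightarrow> p a \<in> T"
    and "\<And>i a. i < n \<Longrightarrow> a \<in> S \<Longrightarrow> f i a \<in> S"
    and "\<And>i a. i < n \<Longrightarrow> a \<in> S \<Longrightarrow> p (f i a) = g i (p a)"
  shows "lumping S T (bell_generator n x f) (bell_generator n x g) p"
proof
  fix a b assume ab: "a \<in> S" "b \<in> T"
  \<comment> \<open>Applied both to \<open>a\<close> and to \<open>f i a\<close>; the latter is in
    \<open>S\<close> by closure under the bells.\<close>
  have *: "(\<Sum>c | c \<in> S \<and> p c = b. of_bool (a' = c)) = (of_bool (p a' = b) :: real)" if "a' \<in> S" for a'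
    using that assms(1) by (simp add: of_bool_def sum.delta)
  have "(\<Sum>c | c \<in> S \<and> p c = b. bell_generator n x f a c) =
      (\<Sum>i<n. 1 / x i * ((\<Sum>c | c \<in> S \<and> p c = b. of_bool (f i a = c)) - (\<Sum>c | c \<in> S \<and> p c = b. of_bool (a = c))))"
    unfolding bell_generator_def by (subst sum.swap) (simp only: sum_distrib_left[symmetric] sum_subtractf)
  also have "\<dots> = bell_generator n x g (p a) b"
    unfolding bell_generator_def using ab assms(4,5) by (intro sum.cong refl) (simp add: *)
  finally show "(\<Sum>c | c \<in> S \<and> p c = b. bell_generator n x f a c) = bell_generator n x g (p a) b" .
qed (use assms in auto)

theorem lemma15:
  fixes s n :: nat
    and m :: "nat \<Rightarrow> nat"
    and x :: "nat \<Rightarrow> real"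
    and M :: "'w measure"
    and X :: "real \<Rightarrow> 'w \<Rightarrow> multiline"
  assumes "n = num_parts s m"
    and "m 0 \<ge> 1"
    and "\<And>i. i < n \<Longrightarrow> x i > 0"
    and "multiline_process M s m x X"
    and "in_stationarity M (multiline_states s m) X"
  shows "pushTASEP M s m x (\<lambda>u \<omega>. multiline_projection n s (X u \<omega>)) \<and>
         in_stationarity M (pushTASEP_states s m) (\<lambda>u \<omega>. multiline_projection n s (X u \<omega>))"
proof -
  interpret lumping "multiline_states s m" "pushTASEP_states s m"
    "bell_generator n x (multiline_bell n s)" "bell_generator n x pushTASEP_bell"
    "multiline_projection n s"
    unfolding assms(1)
    by (rule lumping_bell_generator)
      (simp_all add: finite_multiline_states pushTASEP_states_def[of s m] assms(2)
        multiline_projection_state[unfolded pushTASEP_states_def] multiline_projection_bell[of m, OF assms(2)])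
  have X: "markov_chain M (multiline_states s m) (bell_generator n x (multiline_bell n s)) X"
    using assms(1,4) by (simp add: multiline_process_def)
  show ?thesis
    using markov_chain_lump[OF X] in_stationarity_lump[OF X assms(5)] assms(1)
    by (simp add: pushTASEP_def)
qed

end
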